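(* Assume that $\rho(\cdot,y)$ is convex and Lipschitz with constant $L>0$ for each $y\in\{0,1\}$, that $X_{ij}\sim Subg(\sigma_{jn}^2)$, and that $\beta^*$ exists and is unique. Let $k_n\in\mathbb{N}_+$ be some deterministic sequence. Assume that: (a) for some constants $\vartheta,\delta,\varepsilon>0$ (not depending on $n$) and non-negative definite matrices $H=H_n\in\mathbb{R}^{p_n\times p_n}$ the margin condition holds: $R(b)-R(\beta^* )\ge\frac{\vartheta}{2}(b-\beta^* )^TH(b-\beta^* )$ for all $b$ with $b-\beta^*\in\mathcal{C}_\varepsilon\cap B_1(\delta)$; (b) for some constants $\epsilon,\theta>0$ (not depending on $n$) and every $w\subseteq\{1,\dots,p_n\}$ with $|w|\le k_n$: $R(b)-R(\beta^* )\ge\theta\|b-\beta^*\|_2^2$ for all $b\in\mathbb{R}^{p_n}$ with $\operatorname{supp}b\subseteq w$ and $\|b-\beta^*\|_2\le\epsilon$; (c) $|s^*|\le k_n$; (d) $P(\forall w\in\mathcal{M}_{SS}:|w|\le k_n)\to1$; (e) $\liminf_n\kappa_H(\varepsilon)>0$; (f) $\log(p_n\vee2)=o(n\lambda^2)$; (g) $k_n\lambda=o(\min\{\beta^*_{min},1\})$; (h) $k_n\log(p_n\vee2)=o(n)$; (i) $k_n\log(p_n\vee2)=o(a_n)$; (j) $a_nk_n=o(n\min\{\beta^*_{min},1\}^2)$. Then for the SS procedure $P(\hat s^*=s^* )\to1$ as $n\to\infty$.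
   Context: For each $n$, $(X,Y)=(X^{(n)},Y^{(n)})$ is a random element of $\mathbb{R}^{p_n}\times\{0,1\}$ and $(X_i,Y_i)$, $i=1,\dots,n$, are iid copies of it, $X_i=(X_{i1},\dots,X_{ip_n})^T$; the index $n$ is suppressed, and $\beta^*,s^*,\beta^*_{min}$ may depend on $n$. A random variable $Z$ is $Subg(\sigma^2)$ if $E\exp(tZ)\le\exp(t^2\sigma^2/2)$ for all $t\in\mathbb{R}$. $s_n=\max_{1\le j\le p_n}\sigma_{jn}$. Standing assumptions: $\limsup_ns_n^2<\infty$; no nontrivial linear combination of the coordinates of $X$ is almost surely constant. For $\rho:\mathbb{R}\times\{0,1\}\to\mathbb{R}$ the risk and the empirical risk are $R(b)=E\rho(b^TX,Y)$ and $R_n(b)=\frac1n\sum_{i=1}^n\rho(b^TX_i,Y_i)$, $b\in\mathbb{R}^{p_n}$. $\beta^*=\arg\min_{b\in\mathbb{R}^{p_n}}R(b)$, $s^*=\operatorname{supp}\beta^*=\{i:\beta^*_i\ne0\}$, $s^{*c}=\{1,\dots,p_n\}\setminus s^*$, $\beta^*_{min}=\min_{i\in s^*}|\beta^*_i|$. $v_\pi$ denotes the restriction of $v$ to the coordinates in $\pi$. $\mathcal{C}_\varepsilon=\{\Delta\in\mathbb{R}^{p_n}:\|\Delta_{s^{*c}}\|_1\le(3+\varepsilon)\|\Delta_{s^*}\|_1\}$, $B_1(r)=\{\Delta\in\mathbb{R}^{p_n}:\|\Delta\|_1\le r\}$, $\kappa_H(\varepsilon)=\inf_{\Delta\in\mathcal{C}_\varepsilon\setminus\{0\}}\frac{\Delta^TH\Delta}{\Delta^T\Delta}$.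 Infima and minima over the empty set are $+\infty$. $a\vee b=\max(a,b)$. For $w\subseteq\{1,\dots,p_n\}$, $\hat\beta(w)=\arg\min\{R_n(b):b\in\mathbb{R}^{p_n},\ \operatorname{supp}b\subseteq w\}$ and $GIC(w)=nR_n(\hat\beta(w))+a_n|w|$, where $a_n>0$ is a given (deterministic) penalty. SS (Screening and Selection) procedure, with deterministic $\lambda=\lambda_n>0$: (1) choose $\lambda$; (2) find $\hat\beta_L=\arg\min_{b\in\mathbb{R}^{p_n}}\{R_n(b)+\lambda\|b\|_1\}$; (3) write $\operatorname{supp}\hat\beta_L=\{j_1,\dots,j_k\}$ with $|\hat\beta_{L,j_1}|\ge\dots\ge|\hat\beta_{L,j_k}|>0$; (4) put $\mathcal{M}_{SS}=\{\emptyset,\{j_1\},\{j_1,j_2\},\dots,\{j_1,\dots,j_k\}\}$; (5) put $\hat s^*=\arg\min_{w\in\mathcal{M}_{SS}}GIC(w)$. *)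

theory Defs
  imports "HOL-Probability.Probability" "HOL-Library.Landau_Symbols"
begin

text \<open>
  Since the dimension \<open>p\<close> changes along the sequence, vectors of \<open>\<real>\<^sup>p\<close> are functions on the
  index set \<open>{1..p}\<close>, extensional outside it; thus \<open>Rvec p\<close> is the underlying space of the
  \<open>p\<close>-fold product of \<open>borel\<close>.
\<close>

definition Rvec :: "nat \<Rightarrow> (nat \<Rightarrow> real) set" where
  "Rvec p = {1..p} \<rightarrow>\<^sub>E UNIV"

definition XY_space :: "nat \<Rightarrow> ((nat \<Rightarrow> real) \<times> nat) measure" where
  "XY_space p = (\<Pi>\<^sub>M j\<in>{1..p}. borel) \<Otimes>\<^sub>M count_space {0, 1}"

definition vdiff :: "nat \<Rightarrow> (nat \<Rightarrow> real) \<Rightarrow> (nat \<Rightarrow> real) \<Rightarrow> nat \<Rightarrow> real" where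
  "vdiff p b c = (\<lambda>j\<in>{1..p}. b j - c j)"

definition dotp :: "nat \<Rightarrow> (nat \<Rightarrow> real) \<Rightarrow> (nat \<Rightarrow> real) \<Rightarrow> real" where
  "dotp p b x = (\<Sum>j=1..p. b j * x j)"

definition supp :: "nat \<Rightarrow> (nat \<Rightarrow> real) \<Rightarrow> nat set" where
  "supp p b = {j \<in> {1..p}. b j \<noteq> 0}"

text \<open>\<open>norm1 A v\<close> is the \<open>\<ell>\<^sub>1\<close> norm of the restriction of \<open>v\<close> to the coordinates in \<open>A\<close>;
  the analogous \<open>\<ell>\<^sub>2\<close> norm is \<^const>\<open>L2_set\<close>.\<close>

definition norm1 :: "nat set \<Rightarrow> (nat \<Rightarrow> real) \<Rightarrow> real" where
  "norm1 A v = (\<Sum>j\<in>A. \<bar>v j\<bar>)"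

definition qform :: "nat \<Rightarrow> (nat \<Rightarrow> nat \<Rightarrow> real) \<Rightarrow> (nat \<Rightarrow> real) \<Rightarrow> real" where
  "qform p H v = (\<Sum>i=1..p. \<Sum>j=1..p. v i * H i j * v j)"

definition nonneg_definite :: "nat \<Rightarrow> (nat \<Rightarrow> nat \<Rightarrow> real) \<Rightarrow> bool" where
  "nonneg_definite p H \<longleftrightarrow>
     (\<forall>i\<in>{1..p}. \<forall>j\<in>{1..p}. H i j = H j i) \<and> (\<forall>v\<in>Rvec p. qform p H v \<ge> 0)"

definition l1_ball :: "nat \<Rightarrow> real \<Rightarrow> (nat \<Rightarrow> real) set" where
  "l1_ball p r = {v \<in> Rvec p. norm1 {1..p} v \<le> r}"

definition cone_set :: "nat \<Rightarrow> nat set \<Rightarrow> real \<Rightarrow> (nat \<Rightarrow> real) set" where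
  "cone_set p s e = {v \<in> Rvec p. norm1 ({1..p} - s) v \<le> (3 + e) * norm1 s v}"

text \<open>The next two are extended-real valued, so that an infimum over the empty set is \<open>\<infinity>\<close>.\<close>

definition kappa :: "nat \<Rightarrow> nat set \<Rightarrow> (nat \<Rightarrow> nat \<Rightarrow> real) \<Rightarrow> real \<Rightarrow> ereal" where
  "kappa p s H e =
     (INF v \<in> cone_set p s e - {\<lambda>j\<in>{1..p}. 0}. ereal (qform p H v / (\<Sum>j=1..p. (v j)\<^sup>2)))"

definition beta_min :: "nat \<Rightarrow> (nat \<Rightarrow> real) \<Rightarrow> ereal" where
  "beta_min p b = (INF i \<in> supp p b. ereal \<bar>b i\<bar>)"

text \<open>The integrability clause makes the exponential moment finite; the Bochner integral of a
  non-integrable function is \<open>0\<close>.\<close>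

definition subgaussian :: "'a measure \<Rightarrow> ('a \<Rightarrow> real) \<Rightarrow> real \<Rightarrow> bool" where
  "subgaussian M Z v \<longleftrightarrow> Z \<in> borel_measurable M \<and>
     (\<forall>t::real. integrable M (\<lambda>\<omega>. exp (t * Z \<omega>)) \<and>
        (\<integral>\<omega>. exp (t * Z \<omega>) \<partial>M) \<le> exp (t\<^sup>2 * v / 2))"

definition risk ::
  "(real \<Rightarrow> nat \<Rightarrow> real) \<Rightarrow> nat \<Rightarrow> 'a measure \<Rightarrow> ('a \<Rightarrow> nat \<Rightarrow> real) \<Rightarrow> ('a \<Rightarrow> nat) \<Rightarrow> (nat \<Rightarrow> real) \<Rightarrow> real"
where
  "risk \<rho> p M X Y b = (\<integral>\<omega>. \<rho> (dotp p b (X \<omega>)) (Y \<omega>) \<partial>M)"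

definition emp_risk ::
  "(real \<Rightarrow> nat \<Rightarrow> real) \<Rightarrow> nat \<Rightarrow> nat \<Rightarrow> (nat \<Rightarrow> 'a \<Rightarrow> nat \<Rightarrow> real) \<Rightarrow> (nat \<Rightarrow> 'a \<Rightarrow> nat) \<Rightarrow> 'a \<Rightarrow> (nat \<Rightarrow> real) \<Rightarrow> real"
where
  "emp_risk \<rho> p n X Y \<omega> b = 1 / real n * (\<Sum>i=1..n. \<rho> (dotp p b (X i \<omega>)) (Y i \<omega>))"

text \<open>Minimizers of the empirical criteria need be neither unique nor, for every sample, existent
  (e.g. logistic loss and separable data). \<open>selects_arg_min f S x\<close> says that \<open>x\<close> is an arbitrary
  choice of minimizer of \<open>f\<close> over \<open>S\<close>, with no constraint on \<open>x\<close> if there is none.\<close>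

definition selects_arg_min :: "('b \<Rightarrow> real) \<Rightarrow> 'b set \<Rightarrow> 'b \<Rightarrow> bool" where
  "selects_arg_min f S x \<longleftrightarrow>
     ((\<exists>y. is_arg_min f (\<lambda>y. y \<in> S) y) \<longrightarrow> is_arg_min f (\<lambda>y. y \<in> S) x)"

definition decreasing_order_of_supp :: "nat \<Rightarrow> (nat \<Rightarrow> real) \<Rightarrow> nat list \<Rightarrow> bool" where
  "decreasing_order_of_supp p b js \<longleftrightarrow>
     distinct js \<and> set js = supp p b \<and> sorted_wrt (\<lambda>i j. \<bar>b i\<bar> \<ge> \<bar>b j\<bar>) js"

definition nested_family :: "nat list \<Rightarrow> nat set set" where
  "nested_family js = (\<lambda>m. set (take m js)) ` {0..length js}"

definition gic :: "nat \<Rightarrow> ((nat \<Rightarrow> real) \<Rightarrow> real) \<Rightarrow> (nat set \<Rightarrow> nat \<Rightarrow> real) \<Rightarrow> real \<Rightarrow> nat set \<Rightarrow> real" where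
  "gic n Rn \<beta>h a w = real n * Rn (\<beta>h w) + a * real (card w)"

text \<open>Arbitrary choices of minimizers and of the order of ties need not be measurable, so
  probabilities of events involving them are read as inner probabilities. On measurable events
  this is the ordinary probability.\<close>

definition inner_prob :: "'a measure \<Rightarrow> 'a set \<Rightarrow> real" where
  "inner_prob M A = (SUP B \<in> {B \<in> sets M. B \<subseteq> A}. measure M B)"

lemma (in prob_space) inner_prob_eq_prob:
  assumes "A \<in> events"
  shows "inner_prob M A = prob A"
  unfolding inner_prob_def
proof (rule cSup_eq_maximum)
  show "prob A \<in> prob ` {B \<in> events. B \<subseteq> A}"
    using assms by blast
next
  fix x assume "x \<in> prob ` {B \<in> events. B \<subseteq> A}"
  then show "x \<le> prob A"
    using assms by (auto intro: finite_measure_mono)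
qed

end

theory Submission
  imports Defs
begin

text \<open>
  Only the one-sided deviation \<open>(R b - R \<beta>*) - (R_n b - R_n \<beta>*)\<close> has to be controlled. Symmetrization,
  contraction and the subgaussian maximal inequality bound the expectation of its supremum over
  \<open>\<parallel>b - \<beta>*\<parallel>\<^sub>1 \<le> r\<close> by a multiple of \<open>r sqrt (log p / n)\<close>, and Markov's inequality suffices for the given
  rates. A convex function that is larger on a sphere than at its centre is larger outside as well. On
  an \<open>\<ell>\<^sub>1\<close> sphere of radius of order \<open>k \<lambda>\<close> this localizes the Lasso near \<open>\<beta>*\<close>; as \<open>k \<lambda>\<close> is
  negligible compared to \<open>\<beta>*_min\<close>, the coordinates of \<open>s*\<close> come first in the ordering, so every
  model in the nested family is comparable with \<open>s*\<close>, which itself belongs to the family. On an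
  \<open>\<ell>\<^sub>2\<close> sphere of squared radius \<open>a / (\<theta> n)\<close> it shows that a larger model gains at most \<open>a / 2\<close> in
  \<open>n R_n\<close>, less than its additional penalty; on an \<open>\<ell>\<^sub>2\<close> sphere of radius proportional to
  \<open>min \<beta>*_min 1\<close> it shows that a smaller model loses more than \<open>a k\<close>.
\<close>

section \<open>Symmetrization and contraction\<close>

text \<open>Minimizers and tie orders are arbitrary, hence possibly non-measurable functions of the
  sample. All randomness is therefore confined to three events \<open>Bad n q t\<close> that speak
  of every point of an l1 ball and of no estimator. Off their union \<open>B n\<close>, for large
  \<open>n\<close> and while no candidate model has more than \<open>k n\<close> elements, the
  argument is deterministic and holds for every choice. No union bound over models is made:
  differences supported on k coordinates with l2 length at most q lie in one l1 ball of radius sqrt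
  k * q, so a single supremum serves all models. Markov's inequality charges an event the ratio of
  l1 radius to threshold, times sqrt (log p / n). For the Lasso this is r against lam * r / 4,
  leaving the root of log p / (n lam^2) up to a constant. For submodels it is sqrt k * q against
  \<theta> q^2 / 2, leaving the root of k log p / (n q^2). The two choices of q turn this fraction,
  up to constants, into k log p / a and into at most (k log p / a) * (a k / (n m^2)), where m is the
  minimal signal truncated at 1.\<close>

lemma integrable_Max:
  fixes f :: "'b \<Rightarrow> 'a \<Rightarrow> real"
  assumes "finite T" "T \<noteq> {}" "\<And>b. b \<in> T \<Longrightarrow> integrable M (f b)"
  shows "integrable M (\<lambda>z. MAX b\<in>T. f b z)"
  using assms
proof (induction T rule: finite_ne_induct)
  case (insert x F)
  then have "integrable M (\<lambda>z. max (f x z) (MAX b\<in>F. f b z))"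
    by (intro integrable_max) auto
  with insert show ?case by simp
qed simp

text \<open>No ghost sample is needed: the left maximum is at most the average of the maxima of
  \<open>h + 2 E g\<close> and \<open>h - 2 g\<close>, Jensen's inequality applies to the former, and the two maxima can then
  be contracted jointly.\<close>

lemma (in prob_space) integral_Max_centred_le:
  fixes g u :: "'b \<Rightarrow> 'a \<Rightarrow> real" and h :: "'b \<Rightarrow> real"
  assumes T: "finite T" "T \<noteq> {}"
    and g: "\<And>b. b \<in> T \<Longrightarrow> integrable M (g b)"
    and u: "\<And>b. b \<in> T \<Longrightarrow> integrable M (u b)"
    and contr: "\<And>b c z. b \<in> T \<Longrightarrow> c \<in> T \<Longrightarrow> z \<in> space M \<Longrightarrow> \<bar>g b z - g c z\<bar> \<le> \<bar>u b z - u c z\<bar>"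
  shows "(\<integral>z. (MAX b\<in>T. h b + (expectation (g b) - g b z)) \<partial>M)
    \<le> (\<integral>z. ((MAX b\<in>T. h b + 2 * u b z) + (MAX b\<in>T. h b - 2 * u b z)) / 2 \<partial>M)"
proof -
  let ?E = "MAX b\<in>T. h b + 2 * expectation (g b)"
  have int: "integrable M (\<lambda>z. MAX b\<in>T. h b + 2 * f b z)"
    "integrable M (\<lambda>z. MAX b\<in>T. h b - 2 * f b z)"
    if "\<And>b. b \<in> T \<Longrightarrow> integrable M (f b)" for f :: "'b \<Rightarrow> 'a \<Rightarrow> real"
    using T that by (auto intro!: integrable_Max)
  have jensen: "?E \<le> (\<integral>z. (MAX b\<in>T. h b + 2 * g b z) \<partial>M)"
  proof (intro Max.boundedI)
    fix x assume "x \<in> (\<lambda>b. h b + 2 * expectation (g b)) ` T"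
    then obtain b where b: "b \<in> T" "x = h b + 2 * expectation (g b)" by auto
    have "x = (\<integral>z. h b + 2 * g b z \<partial>M)"
      using b g by (simp add: prob_space)
    also have "\<dots> \<le> (\<integral>z. (MAX b\<in>T. h b + 2 * g b z) \<partial>M)"
      using b g T by (intro integral_mono int) auto
    finally show "x \<le> \<dots>" .
  qed (use T in auto)
  have "(\<integral>z. (MAX b\<in>T. h b + (expectation (g b) - g b z)) \<partial>M)
    \<le> (\<integral>z. (?E + (MAX b\<in>T. h b - 2 * g b z)) / 2 \<partial>M)"
  proof (rule integral_mono)
    show "integrable M (\<lambda>z. MAX b\<in>T. h b + (expectation (g b) - g b z))"
      using T g by (intro integrable_Max) auto
    show "integrable M (\<lambda>z. (?E + (MAX b\<in>T. h b - 2 * g b z)) / 2)"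
      using int(2)[of g] g by auto
    fix z assume "z \<in> space M"
    show "(MAX b\<in>T. h b + (expectation (g b) - g b z)) \<le> (?E + (MAX b\<in>T. h b - 2 * g b z)) / 2"
    proof (intro Max.boundedI)
      fix x assume "x \<in> (\<lambda>b. h b + (expectation (g b) - g b z)) ` T"
      then obtain b where b: "b \<in> T" "x = h b + (expectation (g b) - g b z)" by auto
      have "h b + 2 * expectation (g b) \<le> ?E" "h b - 2 * g b z \<le> (MAX b\<in>T. h b - 2 * g b z)"
        using b T by auto
      from add_mono[OF this] show "x \<le> (?E + (MAX b\<in>T. h b - 2 * g b z)) / 2"
        unfolding b(2) by simp
    qed (use T in auto)
  qed
  also have "\<dots> = (?E + (\<integral>z. (MAX b\<in>T. h b - 2 * g b z) \<partial>M)) / 2"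
    using int(2)[of g] g by (simp add: prob_space)
  also have "\<dots> \<le> ((\<integral>z. (MAX b\<in>T. h b + 2 * g b z) \<partial>M) + (\<integral>z. (MAX b\<in>T. h b - 2 * g b z) \<partial>M)) / 2"
    using jensen by simp
  also have "\<dots> = (\<integral>z. ((MAX b\<in>T. h b + 2 * g b z) + (MAX b\<in>T. h b - 2 * g b z)) / 2 \<partial>M)"
    using int[of g] g by simp
  also have "\<dots> \<le> (\<integral>z. ((MAX b\<in>T. h b + 2 * u b z) + (MAX b\<in>T. h b - 2 * u b z)) / 2 \<partial>M)"
  proof (rule integral_mono)
    fix z assume z: "z \<in> space M"
    obtain b where b: "b \<in> T" "(MAX b\<in>T. h b + 2 * g b z) = h b + 2 * g b z"
      using imageE[OF Max_in[of "(\<lambda>b. h b + 2 * g b z) ` T"]] T by blast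
    obtain c where c: "c \<in> T" "(MAX b\<in>T. h b - 2 * g b z) = h c - 2 * g c z"
      using imageE[OF Max_in[of "(\<lambda>b. h b - 2 * g b z) ` T"]] T by blast
    have "h b + 2 * u b z \<le> (MAX b\<in>T. h b + 2 * u b z)" "h c + 2 * u c z \<le> (MAX b\<in>T. h b + 2 * u b z)"
      "h b - 2 * u b z \<le> (MAX b\<in>T. h b - 2 * u b z)" "h c - 2 * u c z \<le> (MAX b\<in>T. h b - 2 * u b z)"
      using T b c by auto
    \<comment> \<open>With \<open>b\<close> maximizing \<open>h + 2 g\<close> and \<open>c\<close>
      maximizing \<open>h - 2 g\<close>, the sum of the maxima is
      \<open>h b + h c + 2 (g b - g c)\<close>, at most
      \<open>h b + h c + 2 \<bar>u b - u c\<bar>\<close>. Whichever of \<open>u b\<close>,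
      \<open>u c\<close> is larger is put into the maximum with the plus sign, the other into the
      one with the minus sign; this exchange of roles resolves the absolute value.\<close>
    moreover have "(A + B) / 2 \<le> (A' + B') / 2"
      if "A = h b + 2 * g b z" "B = h c - 2 * g c z" "h b + 2 * u b z \<le> A'" "h c + 2 * u c z \<le> A'"
        "h b - 2 * u b z \<le> B'" "h c - 2 * u c z \<le> B'" for A B A' B'
      using that contr[OF b(1) c(1) z] by (cases "u b z \<le> u c z") (simp_all add: abs_if split: if_splits)
    ultimately show "((MAX b\<in>T. h b + 2 * g b z) + (MAX b\<in>T. h b - 2 * g b z)) / 2
       \<le> ((MAX b\<in>T. h b + 2 * u b z) + (MAX b\<in>T. h b - 2 * u b z)) / 2"
      using b(2) c(2) by blast
  qed (use int[of g] int[of u] g u in auto)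
  finally show ?thesis .
qed

text \<open>By Fubini it is enough to compare integrals over coordinate \<open>j\<close> with the
  others frozen at an arbitrary point. This is the device for treating one summand of the empirical
  process at a time.\<close>

lemma integral_PiM_insert_mono:
  fixes F G :: "('i \<Rightarrow> 'z) \<Rightarrow> real"
  assumes D: "\<And>i. prob_space (D i)"
    and F: "integrable (PiM (insert j I) D) F" and G: "integrable (PiM (insert j I) D) G"
    and le: "\<And>x. x \<in> space (PiM I D) \<Longrightarrow> (\<integral>y. F (x(j := y)) \<partial>D j) \<le> (\<integral>y. G (x(j := y)) \<partial>D j)"
  shows "integral\<^sup>L (PiM (insert j I) D) F \<le> integral\<^sup>L (PiM (insert j I) D) G"
proof -
  interpret j: prob_space "D j" by (rule D)
  interpret I: prob_space "PiM I D" by (intro prob_space_PiM D)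
  interpret P: pair_prob_space "D j" "PiM I D" ..
  let ?up = "\<lambda>(y, x). x(j := y)"
  have eq: "PiM (insert j I) D = distr (D j \<Otimes>\<^sub>M PiM I D) (PiM (insert j I) D) ?up"
    by (rule distr_pair_PiM_eq_PiM[symmetric]) (rule D)+
  have up: "?up \<in> measurable (D j \<Otimes>\<^sub>M PiM I D) (PiM (insert j I) D)"
    by measurable
  have int: "integrable (D j \<Otimes>\<^sub>M PiM I D) (\<lambda>(y, x). f (x(j := y)))"
    and split: "integral\<^sup>L (PiM (insert j I) D) f = (\<integral>x. (\<integral>y. f (x(j := y)) \<partial>D j) \<partial>PiM I D)"
    if f: "integrable (PiM (insert j I) D) f" for f :: "('i \<Rightarrow> 'z) \<Rightarrow> real"
  proof -
    have m: "f \<in> borel_measurable (PiM (insert j I) D)" using f by auto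
    have "integrable (D j \<Otimes>\<^sub>M PiM I D) (\<lambda>z. f (?up z))"
      using f by (subst (asm) eq) (rule integrable_distr[OF up])
    then show int: "integrable (D j \<Otimes>\<^sub>M PiM I D) (\<lambda>(y, x). f (x(j := y)))"
      by (simp add: case_prod_unfold)
    have "integral\<^sup>L (PiM (insert j I) D) f = (\<integral>z. f (?up z) \<partial>(D j \<Otimes>\<^sub>M PiM I D))"
      by (subst eq) (rule integral_distr[OF up m])
    then show "integral\<^sup>L (PiM (insert j I) D) f = (\<integral>x. (\<integral>y. f (x(j := y)) \<partial>D j) \<partial>PiM I D)"
      using P.integral_snd[OF int] by (simp add: case_prod_unfold)
  qed
  show ?thesis
    unfolding split[OF F] split[OF G]
    using P.integrable_snd[OF int[OF F]] P.integrable_snd[OF int[OF G]] le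
    by (intro integral_mono[OF _ _ le]) (auto simp: case_prod_unfold)
qed

text \<open>Instead of averaging over Rademacher signs, the larger of the two terms is kept in each step; one
  fixed sign pattern is enough because subgaussianity of \<open>X\<close> and of \<open>-X\<close> are the same.\<close>

lemma integral_Max_symmetrization:
  fixes g u :: "'b \<Rightarrow> 'z \<Rightarrow> real"
  assumes D: "prob_space D" and I: "finite I" and T: "finite T" "T \<noteq> {}"
    and g: "\<And>b. b \<in> T \<Longrightarrow> integrable D (g b)"
    and u: "\<And>b. b \<in> T \<Longrightarrow> integrable D (u b)"
    and contr: "\<And>b c z. b \<in> T \<Longrightarrow> c \<in> T \<Longrightarrow> z \<in> space D \<Longrightarrow> \<bar>g b z - g c z\<bar> \<le> \<bar>u b z - u c z\<bar>"
  obtains e :: "'i \<Rightarrow> real" where "\<And>i. e i \<in> {-1, 1}"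
    and "(\<integral>z. (MAX b\<in>T. \<Sum>i\<in>I. integral\<^sup>L D (g b) - g b (z i)) \<partial>PiM I (\<lambda>_. D))
      \<le> (\<integral>z. (MAX b\<in>T. \<Sum>i\<in>I. 2 * e i * u b (z i)) \<partial>PiM I (\<lambda>_. D))"
proof -
  interpret D: prob_space D by fact
  interpret DD: product_prob_space "\<lambda>_::'i. D" I by unfold_locales
  let ?P = "PiM I (\<lambda>_. D)"
  have comp: "integrable ?P (\<lambda>z. f (z i))" if "i \<in> I" "integrable D f" for i and f :: "'z \<Rightarrow> real"
  proof (rule integrable_distr[of "\<lambda>z. z i" ?P D])
    show "integrable (distr ?P D (\<lambda>z. z i)) f"
      using that DD.PiM_component[of i] by simp
  qed (use that in measurable)
  let ?c = "\<lambda>b z. integral\<^sup>L D (g b) - g b z"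
  \<comment> \<open>Hybrid process: the coordinates in \<open>J\<close> already carry signs, those
    in \<open>I - J\<close> are still centred. \<open>J = {}\<close> is the original process,
    \<open>J = I\<close> the signed one, and the induction moves one coordinate at a time.\<close>
  define S where "S e J b z = (\<Sum>i\<in>J. 2 * e i * u b (z i)) + (\<Sum>i\<in>I - J. ?c b (z i))"
    for e :: "'i \<Rightarrow> real" and J b z
  have S_int: "integrable ?P (S e J b)" if "J \<subseteq> I" "b \<in> T" for e J b
    unfolding S_def using that g u by (intro Bochner_Integration.integrable_add Bochner_Integration.integrable_sum) (auto intro!: comp)
  have main: "\<exists>e :: 'i \<Rightarrow> real. (\<forall>i. e i \<in> {-1, 1}) \<and>
      (\<integral>z. (MAX b\<in>T. S (\<lambda>_. 1) {} b z) \<partial>?P) \<le> (\<integral>z. (MAX b\<in>T. S e J b z) \<partial>?P)"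
    if "finite J" "J \<subseteq> I" for J
    using that
  proof (induction J rule: finite_induct)
    case empty
    show ?case by (intro exI[of _ "\<lambda>_. 1"]) (simp add: S_def)
  next
    case (insert j J)
    then obtain e :: "'i \<Rightarrow> real" where e: "\<And>i. e i \<in> {-1, 1}"
      and le: "(\<integral>z. (MAX b\<in>T. S (\<lambda>_. 1) {} b z) \<partial>?P) \<le> (\<integral>z. (MAX b\<in>T. S e J b z) \<partial>?P)"
      by auto
    have jI: "insert j (I - {j}) = I" "I - J = insert j (I - {j} - J)" "j \<in> I" "J \<subseteq> I"
      using insert by auto
    define F where "F s z = (MAX b\<in>T. S (e(j := s)) (insert j J) b z)" for s z
    have F_int: "integrable ?P (F s)" for s
      unfolding F_def using T insert.prems by (intro integrable_Max S_int) auto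
    \<comment> \<open>With the other coordinates frozen, the hybrids before and after the step share
      a part free of \<open>y\<close>, to which \<open>?c b y\<close>, respectively
      \<open>2 * s * u b y\<close>, is added. This is the shape required by
      \<open>integral_Max_centred_le\<close>.\<close>
    have SJ: "S e J b (x(j := y)) = S e J b (x(j := y)) - ?c b y + ?c b y"
      "S (e(j := s)) (insert j J) b (x(j := y)) = S e J b (x(j := y)) - ?c b y + 2 * s * u b y"
      "S e J b (x(j := y)) - ?c b y = (\<Sum>i\<in>J. 2 * e i * u b (x i)) + (\<Sum>i\<in>I - {j} - J. ?c b (x i))"
      for b x y s
    proof -
      have 1: "(\<Sum>i\<in>J. 2 * e i * u b ((x(j := y)) i)) = (\<Sum>i\<in>J. 2 * e i * u b (x i))"
        "(\<Sum>i\<in>J. 2 * (e(j := s)) i * u b ((x(j := y)) i)) = (\<Sum>i\<in>J. 2 * e i * u b (x i))"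
        using insert by (auto intro!: sum.cong)
      have 2: "(\<Sum>i\<in>I - {j} - J. ?c b ((x(j := y)) i)) = (\<Sum>i\<in>I - {j} - J. ?c b (x i))"
        by (auto intro!: sum.cong)
      have 3: "(\<Sum>i\<in>I - J. ?c b ((x(j := y)) i)) = ?c b y + (\<Sum>i\<in>I - {j} - J. ?c b (x i))"
        using I by (subst jI(2), subst sum.insert) (simp_all add: 2[simplified])
      have 4: "I - insert j J = I - {j} - J" by auto
      show "S e J b (x(j := y)) - ?c b y = (\<Sum>i\<in>J. 2 * e i * u b (x i)) + (\<Sum>i\<in>I - {j} - J. ?c b (x i))"
        unfolding S_def 1 3 by simp
      then show "S (e(j := s)) (insert j J) b (x(j := y)) = S e J b (x(j := y)) - ?c b y + 2 * s * u b y"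
        unfolding S_def using insert(1,2) 1(2)
        by (simp add: 4 2[simplified])
    qed simp
    have "(\<integral>z. (MAX b\<in>T. S e J b z) \<partial>?P) \<le> (\<integral>z. (F 1 z + F (-1) z) / 2 \<partial>?P)"
    proof (subst (1 2) jI(1)[symmetric], rule integral_PiM_insert_mono)
      fix x assume "x \<in> space (PiM (I - {j}) (\<lambda>_. D))"
      define h where "h b = (\<Sum>i\<in>J. 2 * e i * u b (x i)) + (\<Sum>i\<in>I - {j} - J. ?c b (x i))" for b
      have "S e J b (x(j := y)) = h b + ?c b y" for b y
        using SJ(1)[of b x y] SJ(3)[of b x y] by (simp add: h_def)
      moreover have "F 1 (x(j := y)) = (MAX b\<in>T. h b + 2 * u b y)"
        "F (-1) (x(j := y)) = (MAX b\<in>T. h b - 2 * u b y)" for y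
        unfolding F_def SJ(2) SJ(3) h_def[symmetric] by simp_all
      ultimately show "(\<integral>y. (MAX b\<in>T. S e J b (x(j := y))) \<partial>D)
          \<le> (\<integral>y. (F 1 (x(j := y)) + F (-1) (x(j := y))) / 2 \<partial>D)"
        using D.integral_Max_centred_le[OF T g u contr, where h = h] by simp
    qed (use D F_int T jI in \<open>auto simp: insert_absorb intro!: integrable_Max S_int\<close>)
    also have "\<dots> = (integral\<^sup>L ?P (F 1) + integral\<^sup>L ?P (F (-1))) / 2"
      using F_int by simp
    also have "\<dots> \<le> max (integral\<^sup>L ?P (F 1)) (integral\<^sup>L ?P (F (-1)))" by simp
    finally obtain s where "s \<in> {-1, 1}" "(\<integral>z. (MAX b\<in>T. S e J b z) \<partial>?P) \<le> integral\<^sup>L ?P (F s)"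
      by (auto simp: max_def split: if_splits)
    moreover from this have "(e(j := s)) i \<in> {-1, 1}" for i
      using e by simp
    ultimately show ?case
      using order_trans[OF le] unfolding F_def by blast
  qed
  then obtain e :: "'i \<Rightarrow> real" where "\<And>i. e i \<in> {-1, 1}"
    "(\<integral>z. (MAX b\<in>T. S (\<lambda>_. 1) {} b z) \<partial>?P) \<le> (\<integral>z. (MAX b\<in>T. S e I b z) \<partial>?P)"
    using I by blast
  then show thesis by (intro that[of e]) (simp_all add: S_def)
qed

section \<open>Convex localization\<close>

lemma is_arg_min_iff_le:
  fixes f :: "'b \<Rightarrow> real"
  shows "is_arg_min f P x \<longleftrightarrow> P x \<and> (\<forall>y. P y \<longrightarrow> f x \<le> f y)"
  by (auto simp: is_arg_min_def not_less)

text \<open>Tychonoff's theorem: extensionality makes the box a product over all of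
  \<open>nat\<close>, with the factor \<open>{undefined}\<close> outside \<open>{1..p}\<close>.
  Coordinates outside \<open>w\<close> get \<open>{-B..B} \<inter> {0}\<close> instead of
  \<open>{0}\<close>, which keeps the identity true for negative \<open>B\<close>.\<close>

lemma compact_Rvec_box:
  "compact {b \<in> Rvec p. supp p b \<subseteq> w \<and> (\<forall>j\<in>{1..p}. \<bar>b j\<bar> \<le> B)}"
proof -
  define S :: "nat \<Rightarrow> real set"
    where "S j = (if j \<in> {1..p} \<inter> w then {-B..B} else if j \<in> {1..p} then {-B..B} \<inter> {0} else {undefined})" for j
  have "compact (S j)" for j
    unfolding S_def by (auto simp: compact_Int)
  then have "compactin (product_topology (\<lambda>_. euclidean) UNIV) (PiE UNIV S)"
    unfolding compactin_PiE by simp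
  then have "compact (PiE UNIV S)"
    by (simp add: euclidean_product_topology)
  moreover have "PiE UNIV S = {b \<in> Rvec p. supp p b \<subseteq> w \<and> (\<forall>j\<in>{1..p}. \<bar>b j\<bar> \<le> B)}"
  proof (rule set_eqI)
    fix b :: "nat \<Rightarrow> real"
    have "b j \<in> S j \<longleftrightarrow> (j \<in> {1..p} \<longrightarrow> (b j \<noteq> 0 \<longrightarrow> j \<in> w) \<and> \<bar>b j\<bar> \<le> B) \<and> (j \<notin> {1..p} \<longrightarrow> b j = undefined)" for j
      by (auto simp: S_def)
    then show "b \<in> PiE UNIV S \<longleftrightarrow> b \<in> {b \<in> Rvec p. supp p b \<subseteq> w \<and> (\<forall>j\<in>{1..p}. \<bar>b j\<bar> \<le> B)}"
      by (simp only: PiE_iff Rvec_def supp_def extensional_def mem_Collect_eq subset_eq) blast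
  qed
  ultimately show ?thesis by simp
qed

text \<open>The empirical risk need not attain its infimum; growth outside of a sphere is what makes the
  choices in \<^const>\<open>selects_arg_min\<close> genuine minimizers, also on subspaces not containing \<open>\<beta>\<close>.\<close>

lemma
  fixes f N :: "(nat \<Rightarrow> real) \<Rightarrow> real"
  assumes cont: "continuous_on (Rvec p) f"
    and conv: "\<And>b c s. b \<in> Rvec p \<Longrightarrow> c \<in> Rvec p \<Longrightarrow> 0 \<le> s \<Longrightarrow> s \<le> 1 \<Longrightarrow>
      f (\<lambda>j\<in>{1..p}. (1 - s) * c j + s * b j) \<le> (1 - s) * f c + s * f b"
    and N_scale: "\<And>v s. 0 \<le> s \<Longrightarrow> N (\<lambda>j\<in>{1..p}. s * v j) = s * N v"
    and N_coord: "\<And>v j. j \<in> {1..p} \<Longrightarrow> \<bar>v j\<bar> \<le> N v"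
    and center: "\<beta> \<in> Rvec p" "supp p \<beta> \<subseteq> W"
    and pos: "\<rho> > 0" "c > 0"
    and sphere: "\<And>b. b \<in> Rvec p \<Longrightarrow> supp p b \<subseteq> W \<Longrightarrow> N (vdiff p b \<beta>) = \<rho> \<Longrightarrow> f \<beta> + c \<le> f b"
  shows convex_growth_outside_sphere:
      "\<And>b. b \<in> Rvec p \<Longrightarrow> supp p b \<subseteq> W \<Longrightarrow> \<rho> \<le> N (vdiff p b \<beta>) \<Longrightarrow>
        f \<beta> + c * N (vdiff p b \<beta>) / \<rho> \<le> f b" (is "PROP ?growth")
    and convex_arg_min_exists:
      "\<And>w. w \<subseteq> W \<Longrightarrow> \<exists>x. is_arg_min f (\<lambda>b. b \<in> {b \<in> Rvec p. supp p b \<subseteq> w}) x"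
proof -
  show growth: "PROP ?growth"
  proof -
    fix b assume b: "b \<in> Rvec p" "supp p b \<subseteq> W" "\<rho> \<le> N (vdiff p b \<beta>)"
    \<comment> \<open>The factor that shrinks \<open>b\<close> towards \<open>\<beta>\<close> onto
      the sphere. Convexity along this segment yields growth linear in the distance, and the
      existence argument relies on that linearity.\<close>
    define s where "s = \<rho> / N (vdiff p b \<beta>)"
    have s: "0 < s" "s \<le> 1" using b pos by (auto simp: s_def)
    define b' where "b' = (\<lambda>j\<in>{1..p}. (1 - s) * \<beta> j + s * b j)"
    have "b' \<in> Rvec p" by (auto simp: b'_def Rvec_def)
    moreover have "supp p b' \<subseteq> W"
      using b center by (force simp: supp_def b'_def)
    moreover have "vdiff p b' \<beta> = (\<lambda>j\<in>{1..p}. s * vdiff p b \<beta> j)"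
      by (auto simp: b'_def vdiff_def algebra_simps)
    then have "N (vdiff p b' \<beta>) = \<rho>"
      using N_scale[of s "vdiff p b \<beta>"] s b pos by (simp add: s_def)
    ultimately have "f \<beta> + c \<le> f b'" by (rule sphere)
    also have "\<dots> \<le> (1 - s) * f \<beta> + s * f b"
      unfolding b'_def using b center s by (intro conv) auto
    finally have "c \<le> s * (f b - f \<beta>)" by (simp add: algebra_simps)
    then have "c / s \<le> f b - f \<beta>" using s by (simp add: field_simps)
    then show "f \<beta> + c * N (vdiff p b \<beta>) / \<rho> \<le> f b" by (simp add: s_def)
  qed
  fix w assume w: "w \<subseteq> W"
  \<comment> \<open>The origin lies in every coordinate subspace, whereas \<open>\<beta>\<close>
    need not. \<open>A\<close> is chosen so that at distance \<open>\<rho> * A\<close> the linear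
    growth has reached \<open>f o0\<close>, and at least 1 so that the growth bound applies; a
    coordinate exceeding \<open>B\<close> forces that distance. A minimizer over the box
    \<open>K\<close> is then one over the whole subspace.\<close>
  define o0 where "o0 = (\<lambda>j\<in>{1..p}. 0 :: real)"
  have o0: "o0 \<in> Rvec p" "supp p o0 = {}" by (auto simp: o0_def Rvec_def supp_def)
  define A where "A = max 1 ((f o0 - f \<beta>) / c)"
  define B where "B = (\<Sum>j=1..p. \<bar>\<beta> j\<bar>) + \<rho> * A"
  define K where "K = {b \<in> Rvec p. supp p b \<subseteq> w \<and> (\<forall>j\<in>{1..p}. \<bar>b j\<bar> \<le> B)}"
  have "A \<ge> 1" by (simp add: A_def)
  then have "B \<ge> 0" using pos by (auto simp: B_def intro!: add_nonneg_nonneg sum_nonneg)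
  then have o0K: "o0 \<in> K" using o0 by (auto simp: K_def) (simp add: o0_def)
  have outside: "f o0 \<le> f b" if b: "b \<in> Rvec p" "supp p b \<subseteq> w" "b \<notin> K" for b
  proof -
    obtain j where j: "j \<in> {1..p}" "B < \<bar>b j\<bar>" using b by (force simp: K_def)
    have "\<bar>\<beta> j\<bar> \<le> (\<Sum>j=1..p. \<bar>\<beta> j\<bar>)" using j by (intro member_le_sum) auto
    then have "\<rho> * A \<le> \<bar>vdiff p b \<beta> j\<bar>" using j by (auto simp: B_def vdiff_def)
    then have N: "\<rho> * A \<le> N (vdiff p b \<beta>)" using N_coord[OF j(1)] order_trans by blast
    then have "\<rho> \<le> N (vdiff p b \<beta>)"
      using mult_left_mono[of 1 A \<rho>] \<open>A \<ge> 1\<close> pos by linarith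
    then have "f \<beta> + c * N (vdiff p b \<beta>) / \<rho> \<le> f b" using growth b w by blast
    moreover have "c * A \<le> c * N (vdiff p b \<beta>) / \<rho>" using N pos by (simp add: field_simps)
    moreover have "f o0 - f \<beta> \<le> c * A" using pos by (auto simp: A_def max_def field_simps)
    ultimately show ?thesis by linarith
  qed
  have "compact K" unfolding K_def by (rule compact_Rvec_box)
  moreover have "continuous_on K f" by (rule continuous_on_subset[OF cont]) (auto simp: K_def)
  ultimately obtain x where x: "x \<in> K" "\<And>y. y \<in> K \<Longrightarrow> f x \<le> f y"
    using continuous_attains_inf[of K f] o0K by blast
  have "f x \<le> f y" if "y \<in> Rvec p" "supp p y \<subseteq> w" for y
    using x(2)[of y] x(2)[OF o0K] outside[OF that] by (cases "y \<in> K") auto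
  moreover have "x \<in> Rvec p" "supp p x \<subseteq> w" using x(1) by (auto simp: K_def)
  ultimately show "\<exists>x. is_arg_min f (\<lambda>b. b \<in> {b \<in> Rvec p. supp p b \<subseteq> w}) x"
    by (auto simp: is_arg_min_iff_le)
qed

section \<open>Norm inequalities; continuity and convexity of the criteria\<close>

lemma norm1_scale: "0 \<le> s \<Longrightarrow> norm1 {1..p} (\<lambda>j\<in>{1..p}. s * v j) = s * norm1 {1..p} v"
  by (simp add: norm1_def sum_distrib_left abs_mult)

lemma L2_set_scale: "0 \<le> s \<Longrightarrow> L2_set (\<lambda>j\<in>{1..p}. s * v j) {1..p} = s * L2_set v {1..p}"
  by (subst L2_set_right_distrib) (auto intro: L2_set_cong)

lemma abs_le_norm1: "finite A \<Longrightarrow> j \<in> A \<Longrightarrow> \<bar>v j\<bar> \<le> norm1 A v"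
  unfolding norm1_def by (rule member_le_sum) auto

lemma abs_le_L2_set: "finite A \<Longrightarrow> j \<in> A \<Longrightarrow> \<bar>v j\<bar> \<le> L2_set v A"
  using member_le_L2_set[of A j "\<lambda>j. \<bar>v j\<bar>"] by (simp add: L2_set_def)

lemma norm1_le_sqrt_card_L2_set:
  assumes "finite A"
  shows "norm1 A v \<le> sqrt (real (card A)) * L2_set v A"
  using L2_set_mult_ineq[of "\<lambda>_. 1" v A] assms by (simp add: norm1_def L2_set_def)

lemma continuous_on_emp_risk:
  assumes lip: "\<And>y. y \<in> {0, 1} \<Longrightarrow> L-lipschitz_on UNIV (\<lambda>t. \<rho> t y)"
    and Ys: "\<And>i. i \<in> {1..n} \<Longrightarrow> Ys i \<omega> \<in> {0, 1}"
  shows "continuous_on S (emp_risk \<rho> p n Xs Ys \<omega>)"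
proof -
  have "continuous_on S (\<lambda>b. \<rho> (dotp p b (Xs i \<omega>)) (Ys i \<omega>))" if i: "i \<in> {1..n}" for i
  proof (rule continuous_on_compose2[where f = "\<lambda>b. dotp p b (Xs i \<omega>)" and t = UNIV])
    show "continuous_on UNIV (\<lambda>t. \<rho> t (Ys i \<omega>))"
      using lip[OF Ys[OF i]] by (rule lipschitz_on_continuous_on)
    show "continuous_on S (\<lambda>b. dotp p b (Xs i \<omega>))"
      unfolding dotp_def
      by (intro continuous_intros continuous_on_subset[OF continuous_on_product_coordinates]) auto
  qed auto
  then show ?thesis
    unfolding emp_risk_def[abs_def] by (intro continuous_intros) auto
qed

lemma dotp_convex_combination:
  "dotp p (\<lambda>j\<in>{1..p}. (1 - s) * c j + s * b j) x = (1 - s) * dotp p c x + s * dotp p b x"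
  unfolding dotp_def sum_distrib_left sum.distrib[symmetric]
  by (intro sum.cong) (auto simp: algebra_simps)

lemma emp_risk_convex:
  assumes convex: "\<And>y. y \<in> {0, 1} \<Longrightarrow> convex_on UNIV (\<lambda>t. \<rho> t y)"
    and Ys: "\<And>i. i \<in> {1..n} \<Longrightarrow> Ys i \<omega> \<in> {0, 1}" and s: "0 \<le> s" "s \<le> 1"
  shows "emp_risk \<rho> p n Xs Ys \<omega> (\<lambda>j\<in>{1..p}. (1 - s) * c j + s * b j)
    \<le> (1 - s) * emp_risk \<rho> p n Xs Ys \<omega> c + s * emp_risk \<rho> p n Xs Ys \<omega> b"
proof -
  have "(\<Sum>i=1..n. \<rho> (dotp p (\<lambda>j\<in>{1..p}. (1 - s) * c j + s * b j) (Xs i \<omega>)) (Ys i \<omega>))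
    \<le> (\<Sum>i=1..n. (1 - s) * \<rho> (dotp p c (Xs i \<omega>)) (Ys i \<omega>) + s * \<rho> (dotp p b (Xs i \<omega>)) (Ys i \<omega>))"
    unfolding dotp_convex_combination
    using convex_onD[OF convex[OF Ys]] s by (intro sum_mono) auto
  also have "\<dots> = (1 - s) * (\<Sum>i=1..n. \<rho> (dotp p c (Xs i \<omega>)) (Ys i \<omega>)) + s * (\<Sum>i=1..n. \<rho> (dotp p b (Xs i \<omega>)) (Ys i \<omega>))"
    by (simp add: sum.distrib sum_distrib_left)
  finally have "1 / real n * (\<Sum>i=1..n. \<rho> (dotp p (\<lambda>j\<in>{1..p}. (1 - s) * c j + s * b j) (Xs i \<omega>)) (Ys i \<omega>))
    \<le> 1 / real n * \<dots>" by (rule mult_left_mono) simp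
  also have "\<dots> = (1 - s) * emp_risk \<rho> p n Xs Ys \<omega> c + s * emp_risk \<rho> p n Xs Ys \<omega> b"
    unfolding emp_risk_def distrib_left by (simp add: mult.left_commute)
  finally show ?thesis unfolding emp_risk_def .
qed

lemma norm1_convex:
  assumes "0 \<le> s" "s \<le> 1"
  shows "norm1 {1..p} (\<lambda>j\<in>{1..p}. (1 - s) * c j + s * b j) \<le> (1 - s) * norm1 {1..p} c + s * norm1 {1..p} b"
proof -
  have "\<bar>(1 - s) * c j + s * b j\<bar> \<le> (1 - s) * \<bar>c j\<bar> + s * \<bar>b j\<bar>" for j
    using abs_triangle_ineq[of "(1 - s) * c j" "s * b j"] assms by (simp add: abs_mult)
  then have "(\<Sum>j=1..p. \<bar>(1 - s) * c j + s * b j\<bar>) \<le> (\<Sum>j=1..p. (1 - s) * \<bar>c j\<bar> + s * \<bar>b j\<bar>)"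
    by (intro sum_mono)
  then show ?thesis by (simp add: norm1_def sum.distrib sum_distrib_left)
qed

lemma continuous_on_norm1: "continuous_on S (norm1 A)"
  unfolding norm1_def[abs_def]
  by (intro continuous_intros continuous_on_subset[OF continuous_on_product_coordinates]) auto

section \<open>Uniform deviation of Lipschitz risks\<close>

text \<open>This is the bound of \<open>t * \<bar>S j\<bar>\<close> by the logarithm of the
  exponential sum, with the logarithm replaced by its tangent at \<open>exp c\<close>. The
  right-hand side is linear in the sum and can be integrated directly; if the expected sum is at
  most \<open>exp c\<close>, its integral is at most \<open>c / t\<close>.\<close>

lemma abs_le_exp_sum:
  fixes S :: "'j \<Rightarrow> real"
  assumes "finite J" "j \<in> J" "t > 0"
  shows "\<bar>S j\<bar> \<le> (c - 1 + exp (- c) * (\<Sum>j\<in>J. exp (t * S j) + exp (- t * S j))) / t"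
proof -
  have "exp (t * \<bar>S j\<bar>) \<le> exp (t * S j) + exp (- t * S j)"
    by (simp add: abs_if)
  also have "\<dots> \<le> (\<Sum>j\<in>J. exp (t * S j) + exp (- t * S j))"
    using assms by (intro member_le_sum) (auto intro: add_nonneg_nonneg)
  finally have "exp (t * \<bar>S j\<bar> - c) \<le> exp (- c) * (\<Sum>j\<in>J. exp (t * S j) + exp (- t * S j))"
    by (simp add: exp_diff exp_minus divide_simps)
  with exp_ge_add_one_self[of "t * \<bar>S j\<bar> - c"]
  have "t * \<bar>S j\<bar> \<le> c - 1 + exp (- c) * (\<Sum>j\<in>J. exp (t * S j) + exp (- t * S j))"
    by linarith
  then show ?thesis using assms by (simp add: field_simps)
qed

lemma lipschitz_onD_abs:
  fixes f :: "real \<Rightarrow> real"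
  assumes "L-lipschitz_on UNIV f" shows "\<bar>f s - f t\<bar> \<le> L * \<bar>s - t\<bar>"
  using lipschitz_onD[OF assms, of s t] by (simp add: dist_real_def)

lemma dotp_vdiff: "dotp p (vdiff p b c) x = dotp p b x - dotp p c x"
  by (simp add: dotp_def vdiff_def left_diff_distrib sum_subtractf)

lemma dotp_diff_le: "\<bar>dotp p b x - dotp p c x\<bar> \<le> (\<Sum>j=1..p. \<bar>b j - c j\<bar> * \<bar>x j\<bar>)"
  unfolding dotp_def sum_subtractf[symmetric] left_diff_distrib[symmetric]
  by (rule order_trans[OF sum_abs]) (simp add: abs_mult)

text \<open>Rounding goes towards zero, so that a vector approximated coordinatewise keeps an l1
  norm no larger than the original and stays in the same closed ball.\<close>

lemma exists_rational_truncation: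
  fixes x e :: real assumes "e > 0"
  shows "\<exists>q\<in>\<rat>. \<bar>q\<bar> \<le> \<bar>x\<bar> \<and> \<bar>q - x\<bar> < e"
proof -
  consider "x = 0" | "x > 0" | "x < 0" by linarith
  then show ?thesis
  proof cases
    case 1 with assms show ?thesis by (intro bexI[of _ 0]) auto
  next
    case 2
    then obtain q where "q \<in> \<rat>" "max 0 (x - e) < q" "q < x"
      using Rats_dense_in_real[of "max 0 (x - e)" x] assms by auto
    then show ?thesis by (intro bexI[of _ q]) auto
  next
    case 3
    then obtain q where "q \<in> \<rat>" "x < q" "q < min 0 (x + e)"
      using Rats_dense_in_real[of x "min 0 (x + e)"] assms by auto
    then show ?thesis by (intro bexI[of _ q]) auto
  qed
qed

text \<open>\<open>D\<close> is the law of one observation at a fixed stage of the sequence and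
  \<open>v\<close> bounds all coordinate variance factors. A sample is a point of a product of
  copies of \<open>D\<close>, which keeps the asymptotics out of the concentration bounds.\<close>

locale lipschitz_risk = prob_space D
  for D :: "((nat \<Rightarrow> real) \<times> nat) measure" +
  fixes p :: nat and \<rho> :: "real \<Rightarrow> nat \<Rightarrow> real" and L v :: real
  assumes sets_D: "sets D = sets (XY_space p)"
    and dim: "1 \<le> p"
    and lip: "\<And>y. y \<in> {0, 1} \<Longrightarrow> L-lipschitz_on UNIV (\<lambda>t. \<rho> t y)"
    and mgf: "\<And>j t. j \<in> {1..p} \<Longrightarrow> integrable D (\<lambda>z. exp (t * fst z j))"
      "\<And>j t. j \<in> {1..p} \<Longrightarrow> expectation (\<lambda>z. exp (t * fst z j)) \<le> exp (t\<^sup>2 * v / 2)"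
begin

abbreviation loss :: "(nat \<Rightarrow> real) \<Rightarrow> (nat \<Rightarrow> real) \<times> nat \<Rightarrow> real" where
  "loss b z \<equiv> \<rho> (dotp p b (fst z)) (snd z)"

lemma L_nonneg: "0 \<le> L"
  using lip[of 0] by (simp add: lipschitz_on_def)

lemma snd_space: "z \<in> space D \<Longrightarrow> snd z \<in> {0, 1}"
  unfolding sets_eq_imp_space_eq[OF sets_D] XY_space_def space_pair_measure space_count_space
  by (simp only: mem_Times_iff)

lemma coord_measurable: "j \<in> {1..p} \<Longrightarrow> (\<lambda>z. fst z j) \<in> borel_measurable D"
  unfolding measurable_cong_sets[OF sets_D refl] XY_space_def by measurable

lemma loss_measurable: "loss b \<in> borel_measurable D"
proof -
  have m: "(\<lambda>t. \<rho> t y) \<in> borel_measurable borel" if "y \<in> {0, 1}" for y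
    by (rule borel_measurable_continuous_onI[OF lipschitz_on_continuous_on[OF lip[OF that]]])
  have d: "(\<lambda>z. dotp p b (fst z)) \<in> borel_measurable D"
    unfolding dotp_def using coord_measurable by (intro borel_measurable_sum) auto
  have s: "snd \<in> measurable D (count_space {0, 1})"
    unfolding measurable_cong_sets[OF sets_D refl] XY_space_def by measurable
  \<comment> \<open>There are only two labels, so joint measurability reduces to two continuous
    functions glued along a measurable set.\<close>
  have "(\<lambda>z. if snd z = 0 then \<rho> (dotp p b (fst z)) 0 else \<rho> (dotp p b (fst z)) 1) \<in> borel_measurable D"
  proof (rule measurable_If)
    show "{z \<in> space D. snd z = 0} \<in> sets D"
      using measurable_sets[OF s, of "{0}"] by (auto simp: vimage_def Int_def conj_commute)
  qed (use measurable_compose[OF d m] in auto)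
  then show ?thesis
    by (rule measurable_cong[THEN iffD1, rotated]) (use snd_space in force)
qed

lemma coord_integrable: assumes "j \<in> {1..p}" shows "integrable D (\<lambda>z. fst z j)"
proof (rule Bochner_Integration.integrable_bound)
  show "integrable D (\<lambda>z. exp (1 * fst z j) + exp (- 1 * fst z j))"
    using mgf(1)[OF assms, of 1] mgf(1)[OF assms, of "-1"] by (intro Bochner_Integration.integrable_add) simp_all
  show "AE z in D. norm (fst z j) \<le> norm (exp (1 * fst z j) + exp (- 1 * fst z j))"
  proof (rule AE_I2)
    fix z :: "(nat \<Rightarrow> real) \<times> nat"
    have "\<bar>fst z j\<bar> \<le> exp (fst z j) + exp (- fst z j)"
      using exp_ge_add_one_self[of "fst z j"] exp_ge_add_one_self[of "- fst z j"]
        exp_gt_zero[of "fst z j"] exp_gt_zero[of "- fst z j"] by (simp only: abs_if split: if_splits) linarith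
    then show "norm (fst z j) \<le> norm (exp (1 * fst z j) + exp (- 1 * fst z j))" by simp
  qed
qed (use coord_measurable assms in auto)

lemma dotp_integrable: "integrable D (\<lambda>z. dotp p b (fst z))"
  unfolding dotp_def using coord_integrable by (intro Bochner_Integration.integrable_sum) auto

lemma loss_diff_le: "z \<in> space D \<Longrightarrow> \<bar>loss b z - loss c z\<bar> \<le> L * \<bar>dotp p b (fst z) - dotp p c (fst z)\<bar>"
  using lipschitz_onD_abs[OF lip[OF snd_space]] .

lemma loss_integrable: "integrable D (loss b)"
proof (rule Bochner_Integration.integrable_bound)
  show "integrable D (\<lambda>z. \<bar>\<rho> 0 0\<bar> + \<bar>\<rho> 0 1\<bar> + L * \<bar>dotp p b (fst z)\<bar>)"
    using dotp_integrable[of b] by auto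
  show "AE z in D. norm (loss b z) \<le> norm (\<bar>\<rho> 0 0\<bar> + \<bar>\<rho> 0 1\<bar> + L * \<bar>dotp p b (fst z)\<bar>)"
  proof (rule AE_I2)
    fix z assume z: "z \<in> space D"
    have "\<bar>loss b z\<bar> \<le> \<bar>\<rho> 0 (snd z)\<bar> + L * \<bar>dotp p b (fst z)\<bar>"
      using lipschitz_onD_abs[OF lip[OF snd_space[OF z]], of "dotp p b (fst z)" 0] by simp
    moreover have "\<bar>\<rho> 0 (snd z)\<bar> \<le> \<bar>\<rho> 0 0\<bar> + \<bar>\<rho> 0 1\<bar>" using snd_space[OF z] by auto
    ultimately show "norm (loss b z) \<le> norm (\<bar>\<rho> 0 0\<bar> + \<bar>\<rho> 0 1\<bar> + L * \<bar>dotp p b (fst z)\<bar>)" by simp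
  qed
qed (rule loss_measurable)

section \<open>Expectation of the largest one-sided deviation\<close>

definition dev :: "(nat \<Rightarrow> real) \<Rightarrow> nat \<Rightarrow> (nat \<Rightarrow> (nat \<Rightarrow> real) \<times> nat) \<Rightarrow> (nat \<Rightarrow> real) \<Rightarrow> real" where
  "dev \<beta> n zs b = (expectation (loss b) - expectation (loss \<beta>))
     - (1 / real n * (\<Sum>i=1..n. loss b (zs i)) - 1 / real n * (\<Sum>i=1..n. loss \<beta> (zs i)))"

text \<open>The weights depend on the sample and need no uniform bound: for each fixed sample they
  are finite, and only continuity in the coefficients is drawn from the estimate, to replace the
  ball by a countable subset.\<close>

lemma dev_lipschitz:
  assumes "\<And>i. i \<in> {1..n} \<Longrightarrow> zs i \<in> space D"
  shows "\<bar>dev \<beta> n zs b - dev \<beta> n zs c\<bar> \<le>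
    (\<Sum>j=1..p. \<bar>b j - c j\<bar> * (L * expectation (\<lambda>z. \<bar>fst z j\<bar>) + 1 / real n * (\<Sum>i=1..n. L * \<bar>fst (zs i) j\<bar>)))"
proof -
  have pw: "\<bar>loss b z - loss c z\<bar> \<le> (\<Sum>j=1..p. \<bar>b j - c j\<bar> * (L * \<bar>fst z j\<bar>))" if "z \<in> space D" for z
  proof -
    have "\<bar>loss b z - loss c z\<bar> \<le> L * (\<Sum>j=1..p. \<bar>b j - c j\<bar> * \<bar>fst z j\<bar>)"
      using order_trans[OF loss_diff_le[OF that] mult_left_mono[OF dotp_diff_le L_nonneg]] .
    then show ?thesis by (simp add: sum_distrib_left mult.left_commute)
  qed
  have int: "integrable D (\<lambda>z. \<bar>b j - c j\<bar> * (L * \<bar>fst z j\<bar>))" if "j \<in> {1..p}" for j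
    using coord_integrable[OF that] by auto
  have "\<bar>expectation (loss b) - expectation (loss c)\<bar> = \<bar>expectation (\<lambda>z. loss b z - loss c z)\<bar>"
    using loss_integrable by simp
  also have "\<dots> \<le> expectation (\<lambda>z. \<bar>loss b z - loss c z\<bar>)"
    by (rule integral_abs_bound)
  also have "\<dots> \<le> expectation (\<lambda>z. \<Sum>j=1..p. \<bar>b j - c j\<bar> * (L * \<bar>fst z j\<bar>))"
    using loss_integrable int pw by (intro integral_mono) auto
  also have "\<dots> = (\<Sum>j=1..p. \<bar>b j - c j\<bar> * (L * expectation (\<lambda>z. \<bar>fst z j\<bar>)))"
    using int by (subst Bochner_Integration.integral_sum) auto
  finally have 1: "\<bar>expectation (loss b) - expectation (loss c)\<bar> \<le> \<dots>" .
  have "\<bar>1 / real n * (\<Sum>i=1..n. loss b (zs i)) - 1 / real n * (\<Sum>i=1..n. loss c (zs i))\<bar>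
    = 1 / real n * \<bar>\<Sum>i=1..n. loss b (zs i) - loss c (zs i)\<bar>"
    by (simp add: sum_subtractf right_diff_distrib[symmetric] diff_divide_distrib[symmetric])
  also have "\<dots> \<le> 1 / real n * (\<Sum>i=1..n. \<bar>loss b (zs i) - loss c (zs i)\<bar>)"
    by (intro mult_left_mono sum_abs) auto
  also have "\<dots> \<le> 1 / real n * (\<Sum>i=1..n. \<Sum>j=1..p. \<bar>b j - c j\<bar> * (L * \<bar>fst (zs i) j\<bar>))"
    using assms pw by (intro mult_left_mono sum_mono) auto
  also have "\<dots> = (\<Sum>j=1..p. \<bar>b j - c j\<bar> * (1 / real n * (\<Sum>i=1..n. L * \<bar>fst (zs i) j\<bar>)))"
    by (subst sum.swap) (simp add: sum_distrib_left sum_divide_distrib mult.left_commute)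
  finally have 2: "\<bar>1 / real n * (\<Sum>i=1..n. loss b (zs i)) - 1 / real n * (\<Sum>i=1..n. loss c (zs i))\<bar> \<le> \<dots>" .
  have "\<bar>dev \<beta> n zs b - dev \<beta> n zs c\<bar> \<le> \<bar>expectation (loss b) - expectation (loss c)\<bar>
      + \<bar>1 / real n * (\<Sum>i=1..n. loss b (zs i)) - 1 / real n * (\<Sum>i=1..n. loss c (zs i))\<bar>"
    unfolding dev_def by linarith
  with 1 2 show ?thesis by (simp add: distrib_left sum.distrib)
qed

text \<open>Independence factorizes the moment generating function. The signs disappear because each
  factor is bounded for every real argument by an expression in its square, and
  \<open>(t * e i)\<^sup>2 = t\<^sup>2\<close>.\<close>

lemma expectation_exp_signed_sum_le:
  fixes e :: "'i \<Rightarrow> real"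
  assumes I: "finite I" and e: "\<And>i. e i \<in> {-1, 1}" and j: "j \<in> {1..p}"
  shows "integrable (PiM I (\<lambda>_. D)) (\<lambda>zs. exp (t * (\<Sum>i\<in>I. e i * fst (zs i) j)))"
    and "(\<integral>zs. exp (t * (\<Sum>i\<in>I. e i * fst (zs i) j)) \<partial>PiM I (\<lambda>_. D)) \<le> exp (real (card I) * (t\<^sup>2 * v / 2))"
proof -
  interpret DD: product_prob_space "\<lambda>_::'i. D" I by unfold_locales
  have eq: "exp (t * (\<Sum>i\<in>I. e i * fst (zs i) j)) = (\<Prod>i\<in>I. exp ((t * e i) * fst (zs i) j))" for zs :: "'i \<Rightarrow> _"
    using I by (simp add: exp_sum sum_distrib_left mult.assoc)
  show "integrable (PiM I (\<lambda>_. D)) (\<lambda>zs. exp (t * (\<Sum>i\<in>I. e i * fst (zs i) j)))"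
    unfolding eq by (rule DD.product_integrable_prod[OF I mgf(1)[OF j]])
  have "(\<integral>zs. exp (t * (\<Sum>i\<in>I. e i * fst (zs i) j)) \<partial>PiM I (\<lambda>_. D))
    = (\<Prod>i\<in>I. expectation (\<lambda>z. exp ((t * e i) * fst z j)))"
    unfolding eq by (rule DD.product_integral_prod[OF I mgf(1)[OF j]])
  also have "\<dots> \<le> (\<Prod>i\<in>I. exp (t\<^sup>2 * v / 2))"
  proof (intro prod_mono conjI)
    fix i
    have "(t * e i)\<^sup>2 = t\<^sup>2" using e[of i] by auto
    then show "expectation (\<lambda>z. exp ((t * e i) * fst z j)) \<le> exp (t\<^sup>2 * v / 2)"
      using mgf(2)[OF j, of "t * e i"] by simp
  qed (auto intro!: integral_nonneg_AE)
  also have "\<dots> = exp (real (card I) * (t\<^sup>2 * v / 2))"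
    by (simp add: exp_of_nat_mult[symmetric])
  finally show "(\<integral>zs. exp (t * (\<Sum>i\<in>I. e i * fst (zs i) j)) \<partial>PiM I (\<lambda>_. D)) \<le> \<dots>" .
qed

text \<open>After symmetrization and contraction the process is linear in
  \<open>b - \<beta>\<close>, and l1/l-infinity duality bounds it by a multiple of \<open>r\<close>
  times the largest coordinate of the signed sum. The cardinality of \<open>T\<close> does not
  enter, which is what permits the later passage to the whole ball.\<close>

lemma expectation_Max_dev_le:
  assumes n: "1 \<le> n" and r: "0 \<le> r"
    and T: "finite T" "T \<noteq> {}" "\<And>b. b \<in> T \<Longrightarrow> norm1 {1..p} (vdiff p b \<beta>) \<le> r"
  shows "(\<integral>zs. (MAX b\<in>T. dev \<beta> n zs b) \<partial>PiM {1..n} (\<lambda>_. D))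
    \<le> 2 * L * r * (1 + v / 2) * sqrt (ln (2 * real p) / real n)"
proof -
  note One_nat_def [simp del]
  interpret DD: product_prob_space "\<lambda>_::nat. D" "{1..n}" by unfold_locales
  let ?P = "PiM {1..n} (\<lambda>_. D)"
  have lnp: "ln (2 * real p) > 0" using dim by simp
  \<comment> \<open>\<open>exp c\<close> bounds the expected sum of the \<open>2 * p\<close>
    exponentials. With this \<open>t\<close> both parts of \<open>c\<close>, the logarithm of their
    number and that of their moment bound, are multiples of \<open>n * t\<^sup>2\<close>, so
    \<open>c / (n * t) = (1 + v / 2) * t\<close>.\<close>
  define t where "t = sqrt (ln (2 * real p) / real n)"
  have t: "t > 0" "t\<^sup>2 = ln (2 * real p) / real n" using lnp n by (auto simp: t_def)
  define c where "c = ln (2 * real p) + real n * (t\<^sup>2 * v / 2)"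
  let ?g = "\<lambda>b z. loss b z - loss \<beta> z" and ?u = "\<lambda>b z. L * dotp p (vdiff p b \<beta>) (fst z)"
  have intg: "integrable D (?g b)" and intu: "integrable D (?u b)" for b
    using loss_integrable dotp_integrable by auto
  have contr: "\<bar>?g b z - ?g b' z\<bar> \<le> \<bar>?u b z - ?u b' z\<bar>" if "z \<in> space D" for b b' z
  proof -
    have "?u b z - ?u b' z = L * (dotp p b (fst z) - dotp p b' (fst z))"
      by (simp add: dotp_vdiff algebra_simps)
    then show ?thesis using loss_diff_le[OF that, of b b'] L_nonneg by (simp add: abs_mult)
  qed
  obtain e :: "nat \<Rightarrow> real" where e: "\<And>i. e i \<in> {-1, 1}"
    and sym: "(\<integral>zs. (MAX b\<in>T. \<Sum>i\<in>{1..n}. expectation (?g b) - ?g b (zs i)) \<partial>?P)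
      \<le> (\<integral>zs. (MAX b\<in>T. \<Sum>i\<in>{1..n}. 2 * e i * ?u b (zs i)) \<partial>?P)"
    by (rule integral_Max_symmetrization[where D = D and I = "{1..n}" and T = T and g = ?g and u = ?u])
       (assumption | rule prob_space_axioms finite_atLeastAtMost T(1,2) intg intu contr that)+
  let ?S = "\<lambda>zs j. \<Sum>i=1..n. e i * fst (zs i) j"
  define Ex where "Ex zs = (\<Sum>j=1..p. exp (t * ?S zs j) + exp (- t * ?S zs j))"
    for zs :: "nat \<Rightarrow> (nat \<Rightarrow> real) \<times> nat"
  define B where "B zs = (c - 1 + exp (- c) * Ex zs) / t"
    for zs :: "nat \<Rightarrow> (nat \<Rightarrow> real) \<times> nat"
  have S_le_B: "\<bar>?S zs j\<bar> \<le> B zs" if "j \<in> {1..p}" for zs j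
    unfolding B_def Ex_def by (rule abs_le_exp_sum[OF finite_atLeastAtMost that t(1)])
  have B_nonneg: "0 \<le> B zs" for zs
    using order_trans[OF abs_ge_zero S_le_B[of 1 zs]] dim by simp
  have bound: "(\<Sum>i\<in>{1..n}. 2 * e i * ?u b (zs i)) \<le> 2 * L * r * B zs" if b: "b \<in> T" for b zs
  proof -
    let ?d = "vdiff p b \<beta>"
    have "(\<Sum>i\<in>{1..n}. 2 * e i * ?u b (zs i)) = 2 * L * (\<Sum>j=1..p. ?d j * ?S zs j)"
      unfolding dotp_def sum_distrib_left
      by (subst sum.swap, intro sum.cong refl) (simp add: mult_ac)
    also have "\<dots> \<le> 2 * L * (\<Sum>j=1..p. \<bar>?d j\<bar> * B zs)"
    proof (intro mult_left_mono sum_mono)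
      fix j assume j: "j \<in> {1..p}"
      have "?d j * ?S zs j \<le> \<bar>?d j\<bar> * \<bar>?S zs j\<bar>" by (metis abs_ge_self abs_mult)
      also have "\<dots> \<le> \<bar>?d j\<bar> * B zs"
        by (intro mult_left_mono S_le_B[OF j]) auto
      finally show "?d j * ?S zs j \<le> \<dots>" .
    qed (use L_nonneg in auto)
    also have "\<dots> = 2 * L * norm1 {1..p} ?d * B zs"
      unfolding norm1_def sum_distrib_right[symmetric] by (simp add: mult.assoc)
    also have "\<dots> \<le> 2 * L * r * B zs"
      using L_nonneg B_nonneg by (intro mult_right_mono mult_left_mono T(3)[OF b]) auto
    finally show ?thesis .
  qed
  have int_exp: "integrable ?P (\<lambda>zs. exp (s * ?S zs j))" if "j \<in> {1..p}" for j s
    using expectation_exp_signed_sum_le(1)[OF _ e that, of "{1..n}" s] by simp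
  have Ex_int: "integrable ?P Ex"
    unfolding Ex_def by (intro Bochner_Integration.integrable_sum Bochner_Integration.integrable_add int_exp)
  then have B_int: "integrable ?P B"
    unfolding B_def by auto
  have comp: "integrable ?P (\<lambda>zs. f (zs i))" if "i \<in> {1..n}" "integrable D f" for i and f :: "_ \<Rightarrow> real"
  proof (rule integrable_distr[of "\<lambda>z. z i" ?P D])
    show "integrable (distr ?P D (\<lambda>z. z i)) f"
      using that DD.PiM_component[of i] by simp
  qed (use that in measurable)
  have dev_eq: "dev \<beta> n zs b = 1 / real n * (\<Sum>i\<in>{1..n}. expectation (?g b) - ?g b (zs i))" for zs b
    using n loss_integrable by (simp add: dev_def sum_subtractf right_diff_distrib diff_divide_distrib)
  have EB: "integral\<^sup>L ?P B \<le> c / t"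
  proof -
    have "(\<Sum>j=1..p. (\<integral>zs. exp (t * ?S zs j) \<partial>?P) + (\<integral>zs. exp (- t * ?S zs j) \<partial>?P))
      \<le> (\<Sum>j=1..p. exp (real n * (t\<^sup>2 * v / 2)) + exp (real n * (t\<^sup>2 * v / 2)))"
      using expectation_exp_signed_sum_le(2)[OF _ e, of "{1..n}" _ t]
        expectation_exp_signed_sum_le(2)[OF _ e, of "{1..n}" _ "- t"]
      by (intro sum_mono add_mono) simp_all
    also have "\<dots> = exp c" using dim by (simp add: c_def exp_add)
    finally have "exp (- c) * (\<Sum>j=1..p. (\<integral>zs. exp (t * ?S zs j) \<partial>?P) + (\<integral>zs. exp (- t * ?S zs j) \<partial>?P))
        \<le> exp (- c) * exp c"
      by (intro mult_left_mono) auto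
    then have le1: "exp (- c) * (\<Sum>j=1..p. (\<integral>zs. exp (t * ?S zs j) \<partial>?P) + (\<integral>zs. exp (- t * ?S zs j) \<partial>?P)) \<le> 1"
      by (simp add: exp_minus)
    have "integral\<^sup>L ?P B = (c - 1 + exp (- c) * integral\<^sup>L ?P Ex) / t"
      unfolding B_def using Ex_int by (simp add: DD.P.prob_space)
    also have "integral\<^sup>L ?P Ex = (\<Sum>j=1..p. (\<integral>zs. exp (t * ?S zs j) + exp (- t * ?S zs j) \<partial>?P))"
      unfolding Ex_def by (rule Bochner_Integration.integral_sum) (intro Bochner_Integration.integrable_add int_exp)
    also have "\<dots> = (\<Sum>j=1..p. (\<integral>zs. exp (t * ?S zs j) \<partial>?P) + (\<integral>zs. exp (- t * ?S zs j) \<partial>?P))"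
      by (intro sum.cong refl Bochner_Integration.integral_add int_exp)
    finally show ?thesis
      using le1 t by (auto intro!: divide_right_mono)
  qed
  have Max_scale: "(MAX b\<in>T. dev \<beta> n zs b) = 1 / real n * (MAX b\<in>T. \<Sum>i\<in>{1..n}. expectation (?g b) - ?g b (zs i))" for zs
    unfolding dev_eq using mono_Max_commute[of "\<lambda>x. 1 / real n * x" "(\<lambda>b. \<Sum>i\<in>{1..n}. expectation (?g b) - ?g b (zs i)) ` T"] T
    by (simp add: monoI divide_right_mono image_image)
  have "(\<integral>zs. (MAX b\<in>T. dev \<beta> n zs b) \<partial>?P)
      = 1 / real n * (\<integral>zs. (MAX b\<in>T. \<Sum>i\<in>{1..n}. expectation (?g b) - ?g b (zs i)) \<partial>?P)"
    unfolding Max_scale by simp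
  also have "\<dots> \<le> 1 / real n * (\<integral>zs. (MAX b\<in>T. \<Sum>i\<in>{1..n}. 2 * e i * ?u b (zs i)) \<partial>?P)"
    by (intro mult_left_mono sym) auto
  also have "\<dots> \<le> 1 / real n * (\<integral>zs. 2 * L * r * B zs \<partial>?P)"
  proof (intro mult_left_mono integral_mono)
    show "integrable ?P (\<lambda>zs. MAX b\<in>T. \<Sum>i\<in>{1..n}. 2 * e i * ?u b (zs i))"
      by (intro integrable_Max T(1,2) Bochner_Integration.integrable_sum integrable_mult_right comp intu)
    show "integrable ?P (\<lambda>zs. 2 * L * r * B zs)"
      by (intro integrable_mult_right B_int)
    show "(MAX b\<in>T. \<Sum>i\<in>{1..n}. 2 * e i * ?u b (zs i)) \<le> 2 * L * r * B zs" for zs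
      using T(1,2) bound by (intro Max.boundedI) auto
  qed simp
  also have "\<dots> = 1 / real n * (2 * L * r * integral\<^sup>L ?P B)"
    by simp
  also have "\<dots> \<le> 1 / real n * (2 * L * r * (c / t))"
    using L_nonneg r by (intro mult_left_mono EB) auto
  also have "\<dots> = 2 * L * r * (1 + v / 2) * t"
  proof -
    have "c = real n * t\<^sup>2 * (1 + v / 2)" using n by (simp add: c_def t algebra_simps)
    then show ?thesis using n t(1) by (simp add: power2_eq_square)
  qed
  finally show ?thesis by (simp add: t_def)
qed

section \<open>Probability bound over the whole l1 ball\<close>

lemma dev_measurable: "(\<lambda>zs. dev \<beta> n zs b) \<in> borel_measurable (PiM {1..n} (\<lambda>_. D))"
proof -
  have "(\<lambda>zs. loss c (zs i)) \<in> borel_measurable (PiM {1..n} (\<lambda>_. D))" if "i \<in> {1..n}" for c i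
    by (rule measurable_compose[OF measurable_component_singleton[OF that] loss_measurable])
  then show ?thesis
    unfolding dev_def
    by (intro borel_measurable_diff borel_measurable_const borel_measurable_times borel_measurable_sum)
qed

lemma dev_integrable: "integrable (PiM {1..n} (\<lambda>_. D)) (\<lambda>zs. dev \<beta> n zs b)"
proof -
  note One_nat_def [simp del]
  interpret DD: product_prob_space "\<lambda>_::nat. D" "{1..n}" by unfold_locales
  let ?P = "PiM {1..n} (\<lambda>_. D)"
  have "integrable ?P (\<lambda>zs. loss c (zs i))" if "i \<in> {1..n}" for c i
  proof (rule integrable_distr[of "\<lambda>z. z i" ?P D])
    show "integrable (distr ?P D (\<lambda>z. z i)) (loss c)"
      using loss_integrable DD.PiM_component[OF that] by simp
  qed (use that in measurable)
  then have s: "integrable ?P (\<lambda>zs. \<Sum>i=1..n. loss c (zs i))" for c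
    by (intro Bochner_Integration.integrable_sum)
  show ?thesis
    unfolding dev_def
    by (intro Bochner_Integration.integrable_diff integrable_mult_right s DD.P.integrable_const)
qed

text \<open>The deviation vanishes at \<open>\<beta>\<close>, so including \<open>\<beta>\<close> in
  \<open>T\<close> makes the maximum nonnegative, as Markov's inequality requires.\<close>

lemma prob_dev_finite_le:
  assumes n: "1 \<le> n" and r: "0 \<le> r" and a: "0 < a"
    and T: "finite T" "\<beta> \<in> T" "\<And>b. b \<in> T \<Longrightarrow> norm1 {1..p} (vdiff p b \<beta>) \<le> r"
  shows "measure (PiM {1..n} (\<lambda>_. D)) {zs \<in> space (PiM {1..n} (\<lambda>_. D)). \<exists>b\<in>T. a < dev \<beta> n zs b}
    \<le> 2 * L * r * (1 + v / 2) * sqrt (ln (2 * real p) / real n) / a"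
proof -
  note One_nat_def [simp del]
  interpret DD: product_prob_space "\<lambda>_::nat. D" "{1..n}" by unfold_locales
  let ?P = "PiM {1..n} (\<lambda>_. D)"
  have T': "T \<noteq> {}" using T(2) by auto
  let ?mx = "\<lambda>zs. MAX b\<in>T. dev \<beta> n zs b"
  have int: "integrable ?P ?mx"
    by (intro integrable_Max T(1) T' dev_integrable)
  have le: "dev \<beta> n zs b \<le> ?mx zs" if "b \<in> T" for zs b
    using T(1) that by (intro Max_ge) auto
  have nonneg: "0 \<le> ?mx zs" for zs
    using le[OF T(2), of zs] by (simp add: dev_def)
  have m: "{zs \<in> space ?P. a \<le> ?mx zs} \<in> sets ?P"
    using borel_measurable_integrable[OF int] by measurable
  have "measure ?P {zs \<in> space ?P. \<exists>b\<in>T. a < dev \<beta> n zs b} \<le> measure ?P {zs \<in> space ?P. a \<le> ?mx zs}"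
    using le by (intro DD.P.finite_measure_mono m) (auto intro: less_imp_le less_le_trans)
  also have "\<dots> \<le> integral\<^sup>L ?P ?mx / a"
    using integral_Markov_inequality_measure[OF int sets.empty_sets _ a] nonneg by simp
  also have "\<dots> \<le> 2 * L * r * (1 + v / 2) * sqrt (ln (2 * real p) / real n) / a"
    using expectation_Max_dev_le[OF n r T(1) T' T(3)] a by (intro divide_right_mono) auto
  finally show ?thesis .
qed

text \<open>A strict exceedance survives a small change of \<open>b\<close>. Rational offsets from
  \<open>\<beta>\<close> are used instead of rational points, because truncating the offset towards
  zero does not leave the ball. The countable set obtained in this way does not depend on the
  sample.\<close>

lemma dev_dense:
  assumes b: "norm1 {1..p} (vdiff p b \<beta>) \<le> r" "a < dev \<beta> n zs b"
    and zs: "\<And>i. i \<in> {1..n} \<Longrightarrow> zs i \<in> space D"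
  shows "\<exists>d \<in> PiE {1..p} (\<lambda>_. \<rat>). norm1 {1..p} d \<le> r \<and> a < dev \<beta> n zs (\<lambda>j\<in>{1..p}. \<beta> j + d j)"
proof -
  have "\<exists>q. \<forall>m j. q m j \<in> \<rat> \<and> \<bar>q m j\<bar> \<le> \<bar>vdiff p b \<beta> j\<bar> \<and> \<bar>q m j - vdiff p b \<beta> j\<bar> < inverse (real (Suc m))"
    using exists_rational_truncation[of "inverse (real (Suc _))"] by (intro choice allI) (meson inverse_positive_iff_positive of_nat_0_less_iff zero_less_Suc)
  then obtain q where q: "\<And>m j. q m j \<in> \<rat>" "\<And>m j. \<bar>q m j\<bar> \<le> \<bar>vdiff p b \<beta> j\<bar>"
    "\<And>m j. \<bar>q m j - vdiff p b \<beta> j\<bar> < inverse (real (Suc m))" by blast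
  let ?d = "\<lambda>m. \<lambda>j\<in>{1..p}. q m j"
  let ?b = "\<lambda>m. \<lambda>j\<in>{1..p}. \<beta> j + ?d m j"
  define K where "K j = L * expectation (\<lambda>z. \<bar>fst z j\<bar>) + 1 / real n * (\<Sum>i=1..n. L * \<bar>fst (zs i) j\<bar>)" for j
  have lim0: "(\<lambda>m. \<bar>?b m j - b j\<bar>) \<longlonglongrightarrow> 0" if "j \<in> {1..p}" for j
  proof (rule tendsto_sandwich[OF _ _ tendsto_const LIMSEQ_inverse_real_of_nat])
    show "\<forall>\<^sub>F m in sequentially. \<bar>?b m j - b j\<bar> \<le> inverse (real (Suc m))"
      using q(3)[of _ j] that by (intro always_eventually allI less_imp_le) (simp add: vdiff_def algebra_simps)
  qed simp
  have "(\<lambda>m. \<Sum>j=1..p. \<bar>?b m j - b j\<bar> * K j) \<longlonglongrightarrow> (\<Sum>j=1..p. 0 * K j)"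
    by (intro tendsto_sum tendsto_mult lim0 tendsto_const)
  then have lim: "(\<lambda>m. \<Sum>j=1..p. \<bar>?b m j - b j\<bar> * K j) \<longlonglongrightarrow> 0" by simp
  have "(\<lambda>m. dev \<beta> n zs (?b m) - dev \<beta> n zs b) \<longlonglongrightarrow> 0"
  proof (rule Lim_null_comparison[OF always_eventually lim], rule allI)
    show "norm (dev \<beta> n zs (?b m) - dev \<beta> n zs b) \<le> (\<Sum>j=1..p. \<bar>?b m j - b j\<bar> * K j)" for m
      unfolding real_norm_def K_def by (rule dev_lipschitz[OF zs])
  qed
  then have "(\<lambda>m. dev \<beta> n zs (?b m)) \<longlonglongrightarrow> dev \<beta> n zs b"
    by (simp add: LIM_zero_iff)
  then have "\<forall>\<^sub>F m in sequentially. a < dev \<beta> n zs (?b m)"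
    using b(2) by (rule order_tendstoD)
  from eventually_happens'[OF sequentially_bot this] obtain m where "a < dev \<beta> n zs (?b m)" ..
  moreover have "norm1 {1..p} (?d m) \<le> norm1 {1..p} (vdiff p b \<beta>)"
    unfolding norm1_def using q(2) by (intro sum_mono) simp
  moreover have "?d m \<in> PiE {1..p} (\<lambda>_. \<rat>)" using q(1) by auto
  ultimately show ?thesis using b(1) by (intro bexI[of _ "?d m"] conjI) linarith+
qed

text \<open>An exceedance occurs in the ball exactly if it occurs in the countable set
  \<open>C\<close>, which is exhausted by increasing finite sets containing \<open>\<beta>\<close>.
  Their exceedance events are measurable, obey one common bound and increase to \<open>Bad\<close>,
  so both claims pass to the limit.\<close>

lemma prob_dev_ball_le:
  assumes n: "1 \<le> n" and r: "0 \<le> r" and a: "0 < a" and \<beta>: "\<beta> \<in> Rvec p"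
  defines "Bad \<equiv> {zs \<in> space (PiM {1..n} (\<lambda>_. D)).
    \<exists>b\<in>Rvec p. norm1 {1..p} (vdiff p b \<beta>) \<le> r \<and> a < dev \<beta> n zs b}"
  shows "Bad \<in> sets (PiM {1..n} (\<lambda>_. D))"
    and "measure (PiM {1..n} (\<lambda>_. D)) Bad \<le> 2 * L * r * (1 + v / 2) * sqrt (ln (2 * real p) / real n) / a"
proof -
  interpret P: prob_space "PiM {1..n} (\<lambda>_. D)" by (intro prob_space_PiM) (rule prob_space_axioms)
  let ?P = "PiM {1..n} (\<lambda>_. D)"
  define sh where "sh d = (\<lambda>j\<in>{1..p}. \<beta> j + d j)" for d :: "nat \<Rightarrow> real"
  define C where "C = sh ` {d \<in> PiE {1..p} (\<lambda>_. \<rat>). norm1 {1..p} d \<le> r}"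
  have sh: "sh d \<in> Rvec p" "norm1 {1..p} (vdiff p (sh d) \<beta>) = norm1 {1..p} d" for d
    by (auto simp: sh_def Rvec_def vdiff_def norm1_def)
  have C: "norm1 {1..p} (vdiff p b \<beta>) \<le> r" "b \<in> Rvec p" if "b \<in> C" for b
    using that sh by (auto simp: C_def)
  have "sh (\<lambda>j\<in>{1..p}. 0) = \<beta>"
    using \<beta> by (auto simp: sh_def Rvec_def PiE_def extensional_def)
  then have \<beta>C: "\<beta> \<in> C"
    unfolding C_def using r by (intro image_eqI[of _ _ "\<lambda>j\<in>{1..p}. 0"]) (auto simp: norm1_def)
  have "countable C"
    unfolding C_def by (intro countable_image countable_Collect countable_PiE countable_rat finite_atLeastAtMost)
  define T where "T m = insert \<beta> (from_nat_into C ` {..m})" for m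
  have T: "finite (T m)" "\<beta> \<in> T m" "T m \<subseteq> C" for m
    using from_nat_into[of C] \<beta>C by (auto simp: T_def)
  have UT: "(\<Union>m. T m) = C"
    using T(3) subset_range_from_nat_into[OF \<open>countable C\<close>] by (force simp: T_def)
  define A where "A m = {zs \<in> space ?P. \<exists>b\<in>T m. a < dev \<beta> n zs b}" for m
  have A_sets: "A m \<in> sets ?P" for m
    unfolding A_def
    by (intro sets.sets_Collect_finite_Ex T(1) borel_measurable_less borel_measurable_const dev_measurable)
  have "Bad = (\<Union>m. A m)"
  proof (intro equalityI subsetI)
    fix zs assume "zs \<in> Bad"
    then obtain b where b: "zs \<in> space ?P" "norm1 {1..p} (vdiff p b \<beta>) \<le> r" "a < dev \<beta> n zs b"
      by (auto simp: Bad_def)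
    have "zs i \<in> space D" if "i \<in> {1..n}" for i
      using b(1) that by (auto simp: space_PiM PiE_iff)
    from dev_dense[OF b(2,3) this] obtain c where "c \<in> C" "a < dev \<beta> n zs c"
      unfolding C_def sh_def by blast
    then show "zs \<in> (\<Union>m. A m)" using b(1) unfolding A_def UT[symmetric] by blast
  next
    fix zs assume "zs \<in> (\<Union>m. A m)"
    then show "zs \<in> Bad" using T(3) C unfolding A_def Bad_def by blast
  qed
  then show "Bad \<in> sets ?P" using A_sets by auto
  have "incseq A" unfolding incseq_def A_def T_def by fastforce
  then have "(\<lambda>m. measure ?P (A m)) \<longlonglongrightarrow> measure ?P Bad"
    unfolding \<open>Bad = (\<Union>m. A m)\<close> using A_sets by (intro P.finite_Lim_measure_incseq) auto
  moreover have "measure ?P (A m) \<le> 2 * L * r * (1 + v / 2) * sqrt (ln (2 * real p) / real n) / a" for m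
    unfolding A_def by (intro prob_dev_finite_le n r a T(1,2) C(1) subsetD[OF T(3)])
  ultimately show "measure ?P Bad \<le> 2 * L * r * (1 + v / 2) * sqrt (ln (2 * real p) / real n) / a"
    by (intro LIMSEQ_le_const2) auto
qed

end

section \<open>From the law of one observation to the iid sample\<close>

lemma lipschitz_risk_distr:
  assumes M: "prob_space M" and Z: "(\<lambda>\<omega>. (X \<omega>, Y \<omega>)) \<in> measurable M (XY_space p)"
    and "1 \<le> p" and lip: "\<And>y. y \<in> {0, 1} \<Longrightarrow> L-lipschitz_on UNIV (\<lambda>t. \<rho> t y)"
    and subg: "\<And>j. j \<in> {1..p} \<Longrightarrow> subgaussian M (\<lambda>\<omega>. X \<omega> j) (s j)"
    and s: "\<And>j. j \<in> {1..p} \<Longrightarrow> s j \<le> v"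
  shows "lipschitz_risk (distr M (XY_space p) (\<lambda>\<omega>. (X \<omega>, Y \<omega>))) p \<rho> L v"
proof -
  interpret prob_space M by fact
  interpret D: prob_space "distr M (XY_space p) (\<lambda>\<omega>. (X \<omega>, Y \<omega>))"
    by (rule prob_space_distr[OF Z])
  have m: "(\<lambda>z. exp (t * fst z j)) \<in> borel_measurable (XY_space p)" if "j \<in> {1..p}" for j t
    using that unfolding XY_space_def by measurable
  show ?thesis
  proof unfold_locales
    fix j t assume j: "j \<in> {1..p}"
    show "integrable (distr M (XY_space p) (\<lambda>\<omega>. (X \<omega>, Y \<omega>))) (\<lambda>z. exp (t * fst z j))"
      using subg[OF j] by (simp add: integrable_distr_eq[OF Z m[OF j]] subgaussian_def)
    have "t\<^sup>2 * s j \<le> t\<^sup>2 * v" using s[OF j] by (intro mult_left_mono) auto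
    then have le: "exp (t\<^sup>2 * s j / 2) \<le> exp (t\<^sup>2 * v / 2)" by simp
    have "expectation (\<lambda>\<omega>. exp (t * X \<omega> j)) \<le> exp (t\<^sup>2 * s j / 2)"
      using subg[OF j] by (simp add: subgaussian_def)
    from order_trans[OF this le] show "D.expectation (\<lambda>z. exp (t * fst z j)) \<le> exp (t\<^sup>2 * v / 2)"
      unfolding integral_distr[OF Z m[OF j]] by simp
  qed (use assms in auto)
qed

text \<open>Independence and equality of laws identify the joint law of the sample with a product of
  copies of the law of \<open>(X, Y)\<close>. \<open>Bad\<close> is the preimage of the
  corresponding event there and inherits its measurability and its bound.\<close>

lemma (in prob_space) prob_deviation_le:
  fixes X Y :: "'a \<Rightarrow> _" and Xs Ys :: "nat \<Rightarrow> 'a \<Rightarrow> _"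
  assumes D: "lipschitz_risk (distr M (XY_space p) (\<lambda>\<omega>. (X \<omega>, Y \<omega>))) p \<rho> L v"
    and Z: "(\<lambda>\<omega>. (X \<omega>, Y \<omega>)) \<in> measurable M (XY_space p)"
    and indep: "indep_vars (\<lambda>_. XY_space p) (\<lambda>i \<omega>. (Xs i \<omega>, Ys i \<omega>)) {1..n}"
    and ident: "\<And>i. i \<in> {1..n} \<Longrightarrow> distr M (XY_space p) (\<lambda>\<omega>. (Xs i \<omega>, Ys i \<omega>))
      = distr M (XY_space p) (\<lambda>\<omega>. (X \<omega>, Y \<omega>))"
    and n: "1 \<le> n" and r: "0 \<le> r" and a: "0 < a" and \<beta>: "\<beta> \<in> Rvec p"
  defines "Bad \<equiv> {\<omega> \<in> space M. \<exists>b\<in>Rvec p. norm1 {1..p} (vdiff p b \<beta>) \<le> r \<and>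
      a < (risk \<rho> p M X Y b - risk \<rho> p M X Y \<beta>) - (emp_risk \<rho> p n Xs Ys \<omega> b - emp_risk \<rho> p n Xs Ys \<omega> \<beta>)}"
  shows "Bad \<in> events"
    and "prob Bad \<le> 2 * L * r * (1 + v / 2) * sqrt (ln (2 * real p) / real n) / a"
proof -
  note One_nat_def [simp del]
  let ?D = "distr M (XY_space p) (\<lambda>\<omega>. (X \<omega>, Y \<omega>))"
  interpret D: lipschitz_risk ?D p \<rho> L v by fact
  let ?P = "PiM {1..n} (\<lambda>_. ?D)"
  let ?Z = "\<lambda>\<omega>. \<lambda>i\<in>{1..n}. (Xs i \<omega>, Ys i \<omega>)"
  have rv: "(\<lambda>\<omega>. (Xs i \<omega>, Ys i \<omega>)) \<in> measurable M (XY_space p)" if "i \<in> {1..n}" for i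
    using indep that by (auto simp: indep_vars_def)
  have "{1..n} \<noteq> {}" using n by simp
  then have "distr M (\<Pi>\<^sub>M i\<in>{1..n}. XY_space p) ?Z = (\<Pi>\<^sub>M i\<in>{1..n}. distr M (XY_space p) (\<lambda>\<omega>. (Xs i \<omega>, Ys i \<omega>)))"
    using indep by (subst (asm) indep_vars_iff_distr_eq_PiM'[OF _ rv]) simp_all
  also have "\<dots> = ?P" by (intro PiM_cong ident refl)
  finally have distr: "distr M (\<Pi>\<^sub>M i\<in>{1..n}. XY_space p) ?Z = ?P" .
  have sets: "sets ?P = sets (\<Pi>\<^sub>M i\<in>{1..n}. XY_space p)" by (intro sets_PiM_cong refl) simp
  have Zm: "?Z \<in> measurable M (\<Pi>\<^sub>M i\<in>{1..n}. XY_space p)"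
    by (intro measurable_restrict rv)
  have risk: "risk \<rho> p M X Y b = D.expectation (D.loss b)" for b
    unfolding risk_def
    by (subst integral_distr[OF Z]) (use D.loss_measurable[of b] in \<open>simp_all add: measurable_cong_sets[OF sets_distr refl]\<close>)
  have dev: "(risk \<rho> p M X Y b - risk \<rho> p M X Y \<beta>) - (emp_risk \<rho> p n Xs Ys \<omega> b - emp_risk \<rho> p n Xs Ys \<omega> \<beta>)
     = D.dev \<beta> n (?Z \<omega>) b" for \<omega> b
    unfolding D.dev_def risk emp_risk_def by simp
  let ?B = "{zs \<in> space ?P. \<exists>b\<in>Rvec p. norm1 {1..p} (vdiff p b \<beta>) \<le> r \<and> a < D.dev \<beta> n zs b}"
  have Bm: "?B \<in> sets (\<Pi>\<^sub>M i\<in>{1..n}. XY_space p)"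
    using D.prob_dev_ball_le(1)[OF n r a \<beta>] by (simp only: sets)
  have Bad: "Bad = ?Z -` ?B \<inter> space M"
    using measurable_space[OF Zm] unfolding Bad_def dev sets_eq_imp_space_eq[OF sets] by blast
  show "Bad \<in> events" unfolding Bad by (rule measurable_sets[OF Zm Bm])
  have "prob Bad = measure ?P ?B"
    unfolding Bad using measure_distr[OF Zm Bm] distr by simp
  also have "\<dots> \<le> 2 * L * r * (1 + v / 2) * sqrt (ln (2 * real p) / real n) / a"
    by (rule D.prob_dev_ball_le(2)[OF n r a \<beta>])
  finally show "prob Bad \<le> \<dots>" .
qed

section \<open>Lasso and information criterion\<close>

lemma vdiff_self_outside: "j \<in> {1..p} \<Longrightarrow> j \<notin> supp p b \<Longrightarrow> j \<notin> supp p c \<Longrightarrow> vdiff p b c j = 0"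
  by (simp add: vdiff_def supp_def)

lemma vdiff_in_Rvec: "vdiff p b c \<in> Rvec p"
  by (auto simp: vdiff_def Rvec_def)

lemma norm1_split: "s \<subseteq> {1..p} \<Longrightarrow> norm1 {1..p} v = norm1 s v + norm1 ({1..p} - s) v"
  unfolding norm1_def by (subst sum.subset_diff) auto

text \<open>On \<open>s\<close> this is the triangle inequality; off \<open>s\<close> the vector
  \<open>\<beta>\<close> vanishes and the difference equals minus the error. The opposite signs are
  what drives the Lasso error into the cone.\<close>

lemma norm1_decomposability:
  assumes s: "supp p \<beta> = s"
  shows "norm1 {1..p} \<beta> - norm1 {1..p} b \<le> norm1 s (vdiff p b \<beta>) - norm1 ({1..p} - s) (vdiff p b \<beta>)"
proof -
  have sub: "s \<subseteq> {1..p}" using s by (auto simp: supp_def)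
  have "norm1 {1..p} \<beta> - norm1 {1..p} b = (\<Sum>j=1..p. \<bar>\<beta> j\<bar> - \<bar>b j\<bar>)"
    by (simp add: norm1_def sum_subtractf)
  also have "\<dots> \<le> (\<Sum>j=1..p. (if j \<in> s then \<bar>vdiff p b \<beta> j\<bar> else - \<bar>vdiff p b \<beta> j\<bar>))"
    using s by (intro sum_mono) (auto simp: supp_def vdiff_def)
  also have "\<dots> = (\<Sum>j\<in>s. \<bar>vdiff p b \<beta> j\<bar>) + (\<Sum>j\<in>{1..p} - s. - \<bar>vdiff p b \<beta> j\<bar>)"
    unfolding sum.subset_diff[OF sub finite_atLeastAtMost]
    using sub by (simp add: add.commute)
  finally show ?thesis by (simp add: norm1_def sum_negf)
qed

lemma norm1_le_sqrt_L2_set: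
  assumes A: "A \<subseteq> {1..p}" "card A \<le> k"
  shows "norm1 A v \<le> sqrt (real k) * L2_set v {1..p}"
proof -
  have "finite A" using A finite_subset by blast
  then have "norm1 A v \<le> sqrt (real (card A)) * L2_set v A" by (rule norm1_le_sqrt_card_L2_set)
  also have "L2_set v A \<le> L2_set v {1..p}"
    unfolding L2_set_def using A by (intro real_sqrt_le_mono sum_mono2) auto
  then have "sqrt (real (card A)) * L2_set v A \<le> sqrt (real k) * L2_set v {1..p}"
    using A by (intro mult_mono) (auto simp: L2_set_nonneg)
  finally show ?thesis .
qed

text \<open>The deviation bound and the margin condition are available only up to l1 distance
  \<open>r\<close>. It therefore suffices that the penalized criterion gains
  \<open>lam * r / 4\<close> on the sphere of that radius; convexity then provides a minimizer and
  rules out one on or beyond the sphere.\<close>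

lemma lasso_localization:
  fixes f R :: "(nat \<Rightarrow> real) \<Rightarrow> real" and r lam K e :: real
  assumes cont: "continuous_on (Rvec p) f"
    and conv: "\<And>b c s. b \<in> Rvec p \<Longrightarrow> c \<in> Rvec p \<Longrightarrow> 0 \<le> s \<Longrightarrow> s \<le> 1 \<Longrightarrow>
      f (\<lambda>j\<in>{1..p}. (1 - s) * c j + s * b j) \<le> (1 - s) * f c + s * f b"
    and \<beta>: "\<beta> \<in> Rvec p" "supp p \<beta> = s" "card s \<le> k"
    and R_min: "\<And>b. b \<in> Rvec p \<Longrightarrow> R \<beta> \<le> R b"
    and margin: "\<And>b. b \<in> Rvec p \<Longrightarrow> vdiff p b \<beta> \<in> cone_set p s e \<Longrightarrow> norm1 {1..p} (vdiff p b \<beta>) \<le> r \<Longrightarrow>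
      K * (L2_set (vdiff p b \<beta>) {1..p})\<^sup>2 \<le> R b - R \<beta>"
    and pos: "0 < lam" "0 < K" "0 < r" "0 < e" and r: "6 * real k * lam \<le> K * r"
    and good: "\<And>b. b \<in> Rvec p \<Longrightarrow> norm1 {1..p} (vdiff p b \<beta>) \<le> r \<Longrightarrow>
      (R b - R \<beta>) - (f b - f \<beta>) \<le> lam * r / 4"
    and sel: "selects_arg_min (\<lambda>b. f b + lam * norm1 {1..p} b) (Rvec p) bL"
  shows "norm1 {1..p} (vdiff p bL \<beta>) < r"
proof -
  let ?F = "\<lambda>b. f b + lam * norm1 {1..p} b"
  have sub: "s \<subseteq> {1..p}" using \<beta>(2) by (auto simp: supp_def)
  have F_cont: "continuous_on (Rvec p) ?F"
    by (intro continuous_intros cont continuous_on_norm1)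
  have F_conv: "?F (\<lambda>j\<in>{1..p}. (1 - s) * c j + s * b j) \<le> (1 - s) * ?F c + s * ?F b"
    if "b \<in> Rvec p" "c \<in> Rvec p" "0 \<le> s" "s \<le> 1" for b c s
  proof -
    have "lam * norm1 {1..p} (\<lambda>j\<in>{1..p}. (1 - s) * c j + s * b j)
        \<le> lam * ((1 - s) * norm1 {1..p} c + s * norm1 {1..p} b)"
      using pos that by (intro mult_left_mono norm1_convex) auto
    with conv[OF that] show ?thesis by (simp add: algebra_simps)
  qed
  have sphere: "?F \<beta> + lam * r / 4 \<le> ?F b" if b: "b \<in> Rvec p" "norm1 {1..p} (vdiff p b \<beta>) = r" for b
  proof (rule ccontr)
    assume "\<not> ?thesis"
    then have lt: "f b - f \<beta> < lam * r / 4 + lam * (norm1 {1..p} \<beta> - norm1 {1..p} b)"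
      by (simp add: algebra_simps)
    let ?d = "vdiff p b \<beta>"
    define u where "u = norm1 s ?d"
    define u' where "u' = norm1 ({1..p} - s) ?d"
    have u: "0 \<le> u'" "r = u + u'"
      using norm1_split[OF sub, of ?d] b(2) by (auto simp: u_def u'_def norm1_def intro: sum_nonneg)
    have "lam * (norm1 {1..p} \<beta> - norm1 {1..p} b) \<le> lam * (u - u')"
      unfolding u_def u'_def using pos by (intro mult_left_mono norm1_decomposability \<beta>(2)) auto
    moreover have "(R b - R \<beta>) - (f b - f \<beta>) \<le> lam * r / 4" using good b by simp
    ultimately have Rb: "R b - R \<beta> < lam * r / 2 + lam * (u - u')" using lt by linarith
    \<comment> \<open>The two tolerances \<open>lam * r / 4\<close>, one from the deviation and one
      from the gain denied by the contradiction hypothesis, add up to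
      \<open>lam * (u + u') / 2\<close>. Nonnegativity of the excess risk then gives the cone
      constant 3.\<close>
    also have "\<dots> = lam * (3 * u - u') / 2" by (simp add: u(2) field_simps)
    finally have Rb: "R b - R \<beta> < lam * (3 * u - u') / 2" .
    then have "0 < lam * (3 * u - u')" using R_min[OF b(1)] by linarith
    then have c3: "u' < 3 * u" using pos by (simp add: zero_less_mult_iff)
    then have "u > 0" using u by linarith
    then have "3 * u \<le> (3 + e) * u" using pos by (intro mult_right_mono) auto
    then have "?d \<in> cone_set p s e"
      using c3 by (simp add: cone_set_def vdiff_in_Rvec u_def u'_def)
    then have "K * (L2_set ?d {1..p})\<^sup>2 \<le> R b - R \<beta>" using margin b by simp
    also have "\<dots> \<le> lam * (3 * u) / 2"
    proof -
      have "lam * (3 * u - u') \<le> lam * (3 * u)" using u pos by (intro mult_left_mono) auto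
      then show ?thesis using Rb by linarith
    qed
    finally have KL: "K * (L2_set ?d {1..p})\<^sup>2 \<le> lam * (3 * u) / 2" .
    \<comment> \<open>Cauchy-Schwarz on the at most \<open>k\<close> coordinates of \<open>s\<close>
      turns the quadratic margin into \<open>K * u \<le> 3 * k * lam / 2\<close>. The cone gives
      \<open>r < 4 * u\<close>, hence \<open>K * r < 6 * k * lam\<close>: this is the origin of the
      constant 6.\<close>
    have "u \<le> sqrt (real k) * L2_set ?d {1..p}"
      unfolding u_def by (rule norm1_le_sqrt_L2_set[OF sub \<beta>(3)])
    then have "u\<^sup>2 \<le> (sqrt (real k) * L2_set ?d {1..p})\<^sup>2" using \<open>u > 0\<close> by (intro power_mono) auto
    then have "u\<^sup>2 \<le> real k * (L2_set ?d {1..p})\<^sup>2" by (simp add: power_mult_distrib)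
    then have "K * u\<^sup>2 \<le> K * (real k * (L2_set ?d {1..p})\<^sup>2)" using pos by simp
    also have "\<dots> \<le> real k * (lam * (3 * u) / 2)"
      using mult_left_mono[OF KL, of "real k"] by (simp add: mult_ac)
    finally have "u * (K * u) \<le> u * (real k * lam * 3 / 2)"
      by (simp add: power2_eq_square algebra_simps)
    then have "K * u \<le> real k * lam * 3 / 2" using \<open>u > 0\<close> by simp
    moreover have "K * r < K * (4 * u)" using u c3 pos by (intro mult_strict_left_mono) auto
    ultimately show False using r by (simp add: algebra_simps)
  qed
  have supp_sub: "supp p b \<subseteq> {1..p}" for b by (auto simp: supp_def)
  have c: "0 < lam * r / 4" using pos by simp
  have "\<exists>x. is_arg_min ?F (\<lambda>b. b \<in> {b \<in> Rvec p. supp p b \<subseteq> {1..p}}) x"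
    by (rule convex_arg_min_exists[where f = ?F and N = "norm1 {1..p}" and W = "{1..p}" and \<rho> = r and c = "lam * r / 4", OF F_cont])
       (assumption | rule F_conv norm1_scale abs_le_norm1 \<beta>(1) supp_sub pos(3) c sphere finite_atLeastAtMost order_refl)+
  then have "is_arg_min ?F (\<lambda>b. b \<in> Rvec p) bL"
    using sel supp_sub by (simp add: selects_arg_min_def)
  then have bL: "bL \<in> Rvec p" "?F bL \<le> ?F \<beta>"
    using \<beta>(1) by (auto simp: is_arg_min_iff_le)
  show ?thesis
  proof (rule ccontr)
    assume "\<not> ?thesis"
    then have ge: "r \<le> norm1 {1..p} (vdiff p bL \<beta>)" by simp
    have "?F \<beta> + lam * r / 4 * norm1 {1..p} (vdiff p bL \<beta>) / r \<le> ?F bL"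
      by (rule convex_growth_outside_sphere[where f = ?F and N = "norm1 {1..p}" and W = "{1..p}" and \<rho> = r and c = "lam * r / 4", OF F_cont])
         (assumption | rule F_conv norm1_scale abs_le_norm1 \<beta>(1) supp_sub pos(3) c sphere bL(1) ge finite_atLeastAtMost order_refl)+
    moreover have "0 < lam * r / 4 * norm1 {1..p} (vdiff p bL \<beta>) / r"
      using c ge pos by (intro divide_pos_pos mult_pos_pos) auto
    ultimately show False using bL(2) by linarith
  qed
qed

text \<open>Support coordinates of \<open>\<beta>\<close> are estimated above \<open>m / 2\<close>
  in absolute value, all others below it. The gap is strict, so no arrangement of ties matters. An
  empty support needs no separate case, as the empty prefix is in the family.\<close>

lemma nested_family_separation:
  assumes close: "\<And>j. j \<in> {1..p} \<Longrightarrow> \<bar>bL j - \<beta> j\<bar> < m / 2"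
    and m: "\<And>j. j \<in> supp p \<beta> \<Longrightarrow> m \<le> \<bar>\<beta> j\<bar>"
    and ord: "decreasing_order_of_supp p bL js"
  shows "supp p \<beta> \<in> nested_family js"
    and "\<And>w. w \<in> nested_family js \<Longrightarrow> w \<subseteq> {1..p} \<and> (w \<subseteq> supp p \<beta> \<or> supp p \<beta> \<subseteq> w)"
proof -
  let ?s = "supp p \<beta>"
  \<comment> \<open>The length of the longest prefix inside the support. A support coordinate
    further on would follow \<open>js ! i0\<close>, which lies outside the support, and this
    contradicts the ordering.\<close>
  define i0 where "i0 = length (takeWhile (\<lambda>j. j \<in> ?s) js)"
  have js: "set js = supp p bL" "sorted_wrt (\<lambda>i j. \<bar>bL j\<bar> \<le> \<bar>bL i\<bar>) js"
    using ord by (auto simp: decreasing_order_of_supp_def)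
  have big: "m / 2 < \<bar>bL j\<bar>" if "j \<in> ?s" for j
  proof -
    have "j \<in> {1..p}" using that by (simp add: supp_def)
    from close[OF this] m[OF that] show ?thesis by linarith
  qed
  have small: "\<bar>bL j\<bar> < m / 2" if "j \<in> set js" "j \<notin> ?s" for j
  proof -
    have "j \<in> {1..p}" "\<beta> j = 0" using that js(1) by (auto simp: supp_def)
    with close[of j] show ?thesis by simp
  qed
  have s_js: "?s \<subseteq> set js"
  proof
    fix j assume j: "j \<in> ?s"
    then have jp: "j \<in> {1..p}" by (simp add: supp_def)
    have "0 < m / 2" using close[OF jp] by linarith
    then show "j \<in> set js" using big[OF j] jp by (auto simp: js supp_def)
  qed
  have pre: "set (take i0 js) = ?s"
  proof (intro equalityI subsetI)
    fix j assume "j \<in> set (take i0 js)"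
    then show "j \<in> ?s" unfolding i0_def takeWhile_eq_take[symmetric] by (rule set_takeWhileD[THEN conjunct2])
  next
    fix j assume j: "j \<in> ?s"
    then obtain i where i: "i < length js" "js ! i = j" using s_js by (metis in_set_conv_nth subsetD)
    have "i < i0"
    proof (rule ccontr)
      assume "\<not> i < i0"
      then have i0: "i0 \<le> i" by simp
      then have "js ! i0 \<notin> ?s" using i nth_length_takeWhile[of "\<lambda>j. j \<in> ?s" js] by (simp add: i0_def)
      moreover from this have "i0 \<noteq> i" using i j by auto
      ultimately show False
        using sorted_wrt_nth_less[OF js(2), of i0 i] i i0 big[OF j] small[of "js ! i0"] by fastforce
    qed
    then show "j \<in> set (take i0 js)" using i by (auto simp: in_set_conv_nth)
  qed
  have "i0 \<le> length js" unfolding i0_def by (rule length_takeWhile_le)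
  then show "?s \<in> nested_family js" unfolding nested_family_def using pre by force
  fix w assume "w \<in> nested_family js"
  then obtain i where w: "w = set (take i js)" by (auto simp: nested_family_def)
  have "w \<subseteq> {1..p}" using set_take_subset[of i js] js(1) w by (auto simp: supp_def)
  moreover have "w \<subseteq> ?s \<or> ?s \<subseteq> w"
    unfolding w pre[symmetric] by (metis nat_le_linear set_take_subset_set_take)
  ultimately show "w \<subseteq> {1..p} \<and> (w \<subseteq> ?s \<or> ?s \<subseteq> w)" ..
qed

text \<open>\<open>W\<close> contains the supports of \<open>\<beta>\<close> and of all competitors,
  so the differences live on at most \<open>k\<close> coordinates and their l2 ball lies inside the
  l1 ball where \<open>good\<close> holds. On the l2 sphere the growth
  \<open>\<theta> * \<rho>\<^sup>2\<close> is twice the deviation allowance, which leaves a gain of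
  \<open>\<theta> * \<rho>\<^sup>2 / 2\<close>. \<open>W = w\<close> serves models containing the
  support, \<open>W = supp p \<beta>\<close> those inside it.\<close>

lemma restricted_min_bounds:
  fixes f R :: "(nat \<Rightarrow> real) \<Rightarrow> real" and \<rho> \<theta> :: real
  assumes cont: "continuous_on (Rvec p) f"
    and conv: "\<And>b c s. b \<in> Rvec p \<Longrightarrow> c \<in> Rvec p \<Longrightarrow> 0 \<le> s \<Longrightarrow> s \<le> 1 \<Longrightarrow>
      f (\<lambda>j\<in>{1..p}. (1 - s) * c j + s * b j) \<le> (1 - s) * f c + s * f b"
    and \<beta>: "\<beta> \<in> Rvec p" "supp p \<beta> \<subseteq> W" and W: "W \<subseteq> {1..p}" "card W \<le> k"
    and R_min: "\<And>b. b \<in> Rvec p \<Longrightarrow> R \<beta> \<le> R b"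
    and strong: "\<And>b. b \<in> Rvec p \<Longrightarrow> supp p b \<subseteq> W \<Longrightarrow> L2_set (vdiff p b \<beta>) {1..p} \<le> \<rho> \<Longrightarrow>
      \<theta> * (L2_set (vdiff p b \<beta>) {1..p})\<^sup>2 \<le> R b - R \<beta>"
    and pos: "0 < \<rho>" "0 < \<theta>"
    and good: "\<And>b. b \<in> Rvec p \<Longrightarrow> norm1 {1..p} (vdiff p b \<beta>) \<le> sqrt (real k) * \<rho> \<Longrightarrow>
      (R b - R \<beta>) - (f b - f \<beta>) \<le> \<theta> * \<rho>\<^sup>2 / 2"
    and w: "w \<subseteq> W" and sel: "selects_arg_min f {b \<in> Rvec p. supp p b \<subseteq> w} bh"
  shows "supp p \<beta> \<subseteq> w \<Longrightarrow> f bh \<le> f \<beta>"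
    and "supp p \<beta> \<subseteq> w \<Longrightarrow> f \<beta> - \<theta> * \<rho>\<^sup>2 / 2 \<le> f bh"
    and "\<And>i. i \<in> supp p \<beta> - w \<Longrightarrow> \<rho> \<le> \<bar>\<beta> i\<bar> \<Longrightarrow> f \<beta> + \<theta> * \<rho>\<^sup>2 / 2 \<le> f bh"
proof -
  let ?N = "\<lambda>v. L2_set v {1..p}"
  have norm1_le: "norm1 {1..p} (vdiff p b \<beta>) \<le> sqrt (real k) * ?N (vdiff p b \<beta>)" if "supp p b \<subseteq> W" for b
  proof -
    have "vdiff p b \<beta> i = 0" if "i \<in> {1..p} - W" for i
      by (rule vdiff_self_outside) (use that \<open>supp p b \<subseteq> W\<close> \<beta>(2) in blast)+
    then have "norm1 {1..p} (vdiff p b \<beta>) = norm1 W (vdiff p b \<beta>)"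
      unfolding norm1_def using W(1) by (intro sum.mono_neutral_right) auto
    then show ?thesis using norm1_le_sqrt_L2_set[OF W] by simp
  qed
  have good': "(R b - R \<beta>) - (f b - f \<beta>) \<le> \<theta> * \<rho>\<^sup>2 / 2"
    if "b \<in> Rvec p" "supp p b \<subseteq> W" "?N (vdiff p b \<beta>) \<le> \<rho>" for b
    by (rule good[OF that(1)], rule order_trans[OF norm1_le[OF that(2)]])
       (use that(3) in \<open>intro mult_left_mono; simp\<close>)
  have sphere: "f \<beta> + \<theta> * \<rho>\<^sup>2 / 2 \<le> f b"
    if b: "b \<in> Rvec p" "supp p b \<subseteq> W" "?N (vdiff p b \<beta>) = \<rho>" for b
    using good'[of b] strong[of b] b by simp
  have c: "0 < \<theta> * \<rho>\<^sup>2 / 2" using pos by simp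
  have coord: "\<bar>v j\<bar> \<le> ?N v" if "j \<in> {1..p}" for v j
    using abs_le_L2_set[OF finite_atLeastAtMost that] .
  have grow: "f \<beta> + \<theta> * \<rho>\<^sup>2 / 2 * ?N (vdiff p b \<beta>) / \<rho> \<le> f b"
    if "b \<in> Rvec p" "supp p b \<subseteq> W" "\<rho> \<le> ?N (vdiff p b \<beta>)" for b
    by (rule convex_growth_outside_sphere[where f = f and N = ?N and W = W and \<rho> = \<rho> and c = "\<theta> * \<rho>\<^sup>2 / 2", OF cont])
       (assumption | rule conv L2_set_scale coord \<beta> pos(1) c sphere that)+
  have "\<exists>x. is_arg_min f (\<lambda>b. b \<in> {b \<in> Rvec p. supp p b \<subseteq> w}) x"
    by (rule convex_arg_min_exists[where f = f and N = ?N and W = W and \<rho> = \<rho> and c = "\<theta> * \<rho>\<^sup>2 / 2", OF cont])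
       (assumption | rule conv L2_set_scale coord \<beta> pos(1) c sphere w)+
  then have "is_arg_min f (\<lambda>b. b \<in> {b \<in> Rvec p. supp p b \<subseteq> w}) bh"
    using sel by (simp add: selects_arg_min_def)
  then have bh: "bh \<in> Rvec p" "supp p bh \<subseteq> w" "\<And>b. b \<in> Rvec p \<Longrightarrow> supp p b \<subseteq> w \<Longrightarrow> f bh \<le> f b"
    by (auto simp: is_arg_min_iff_le)
  have far: "f \<beta> + \<theta> * \<rho>\<^sup>2 / 2 \<le> f bh" if "\<rho> \<le> ?N (vdiff p bh \<beta>)"
  proof -
    have "\<theta> * \<rho>\<^sup>2 / 2 * \<rho> \<le> \<theta> * \<rho>\<^sup>2 / 2 * ?N (vdiff p bh \<beta>)" using that c by (intro mult_left_mono) auto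
    then have "\<theta> * \<rho>\<^sup>2 / 2 \<le> \<theta> * \<rho>\<^sup>2 / 2 * ?N (vdiff p bh \<beta>) / \<rho>" using pos by (simp add: pos_le_divide_eq)
    then show ?thesis using grow[OF bh(1) _ that] bh(2) w by fastforce
  qed
  show "f bh \<le> f \<beta>" if "supp p \<beta> \<subseteq> w" using bh(3)[OF \<beta>(1) that] .
  show "f \<beta> - \<theta> * \<rho>\<^sup>2 / 2 \<le> f bh"
  \<comment> \<open>Outside the ball the criterion even exceeds its value at \<open>\<beta>\<close>;
    inside, nonnegative excess risk together with the deviation bound limits how far it can
    drop.\<close>
  proof (cases "\<rho> \<le> ?N (vdiff p bh \<beta>)")
    case True with far c show ?thesis by linarith
  next
    case False
    then show ?thesis using good'[of bh] R_min[OF bh(1)] bh w by fastforce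
  qed
  show "f \<beta> + \<theta> * \<rho>\<^sup>2 / 2 \<le> f bh" if i: "i \<in> supp p \<beta> - w" "\<rho> \<le> \<bar>\<beta> i\<bar>" for i
  proof (rule far)
    \<comment> \<open>A single omitted coordinate of size at least \<open>\<rho>\<close> already
      puts the restricted minimizer on or outside the sphere.\<close>
    have "i \<in> {1..p}" "bh i = 0" using i bh(2) by (auto simp: supp_def)
    then have "\<bar>vdiff p bh \<beta> i\<bar> = \<bar>\<beta> i\<bar>" by (simp add: vdiff_def)
    then show "\<rho> \<le> ?N (vdiff p bh \<beta>)" using coord[OF \<open>i \<in> {1..p}\<close>, of "vdiff p bh \<beta>"] i by linarith
  qed
qed

text \<open>Both comparisons with \<open>s\<close> are strict, so every minimizer of the criterion
  equals \<open>s\<close> and no rule for ties is needed.\<close>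

lemma gic_selects:
  assumes n: "1 \<le> n" and a: "0 < a" and s: "s \<in> F" "card s \<le> k"
    and nested: "\<And>w. w \<in> F \<Longrightarrow> finite w \<and> (w \<subseteq> s \<or> s \<subseteq> w)"
    and base: "f (bh s) \<le> c"
    and over: "\<And>w. w \<in> F \<Longrightarrow> s \<subset> w \<Longrightarrow> c - a / (2 * real n) \<le> f (bh w)"
    and under: "\<And>w. w \<in> F \<Longrightarrow> w \<subset> s \<Longrightarrow> c + t \<le> f (bh w)" and t: "a * real k < real n * t"
    and sel: "is_arg_min (gic n f bh a) (\<lambda>w. w \<in> F) sh"
  shows "sh = s"
proof (rule ccontr)
  assume ne: "sh \<noteq> s"
  have sh: "sh \<in> F" "gic n f bh a sh \<le> gic n f bh a s"
    using sel s(1) by (auto simp: is_arg_min_iff_le)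
  have fin: "finite sh" "finite s" using nested sh(1) s(1) by auto
  have base': "real n * f (bh s) \<le> real n * c" using base by (intro mult_left_mono) auto
  consider "s \<subset> sh" | "sh \<subset> s" using nested[OF sh(1)] ne by auto
  then show False
  proof cases
    case 1
    then have "real (card s) + 1 \<le> real (card sh)" using psubset_card_mono[OF fin(1) 1] by linarith
    then have "a * (real (card s) + 1) \<le> a * real (card sh)" using a by (intro mult_left_mono) auto
    moreover have "real n * (c - a / (2 * real n)) \<le> real n * f (bh sh)"
      using over[OF sh(1) 1] by (intro mult_left_mono) auto
    moreover have "real n * (c - a / (2 * real n)) = real n * c - a / 2" using n by (simp add: field_simps)
    ultimately show False using sh(2) base' a unfolding gic_def distrib_left by linarith
  next
    case 2
    have "a * real (card s) \<le> a * real k" using a s(2) by (intro mult_left_mono) auto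
    moreover have "0 \<le> a * real (card sh)" using a by simp
    moreover have "real n * (c + t) \<le> real n * f (bh sh)"
      using under[OF sh(1) 2] by (intro mult_left_mono) auto
    ultimately show False using sh(2) base' t unfolding gic_def distrib_left by linarith
  qed
qed

section \<open>Extended-real constants and inner probabilities\<close>

lemma real_of_ereal_beta_min:
  fixes p :: nat and b :: "nat \<Rightarrow> real"
  defines "m \<equiv> real_of_ereal (min (beta_min p b) 1)"
  shows "0 < m" and "m \<le> 1" and "\<And>i. i \<in> supp p b \<Longrightarrow> m \<le> \<bar>b i\<bar>"
proof -
  let ?B = "(\<lambda>i. \<bar>b i\<bar>) ` supp p b"
  have fin: "finite (supp p b)" by (simp add: supp_def)
  \<comment> \<open>For an empty support the minimal signal is infinite; the truncation at 1 comes
    before the conversion to \<open>real\<close>, so \<open>m\<close> is then 1 and not the default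
    value 0.\<close>
  have "m = (if supp p b = {} then 1 else min (Min ?B) 1)"
  proof (cases "supp p b = {}")
    case True
    then show ?thesis by (simp add: m_def beta_min_def top_ereal_def)
  next
    case False
    have "beta_min p b = Min (ereal ` ?B)"
      unfolding beta_min_def using fin False by (simp add: cInf_eq_Min image_image)
    also have "\<dots> = ereal (Min ?B)"
      using fin False by (intro mono_Min_commute[symmetric]) (auto simp: mono_def)
    finally show ?thesis using False by (auto simp: m_def min_def one_ereal_def)
  qed
  note m = this
  have "0 < Min ?B" if "supp p b \<noteq> {}" using that fin by (subst Min_gr_iff) (auto simp: supp_def)
  then show "0 < m" unfolding m by auto
  show "m \<le> 1" unfolding m by auto
  show "m \<le> \<bar>b i\<bar>" if i: "i \<in> supp p b" for i
  proof -
    have "Min ?B \<le> \<bar>b i\<bar>" using fin i by (intro Min_le) auto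
    then show ?thesis unfolding m using i by auto
  qed
qed

text \<open>A real \<open>c\<close> strictly below \<open>kappa\<close> also covers an infinite
  infimum, which occurs when the cone is trivial. The zero vector is excluded from the infimum, but
  both sides vanish there.\<close>

lemma kappa_mult_le_qform:
  assumes c: "ereal c < kappa p s H e" and v: "v \<in> cone_set p s e"
  shows "c * (L2_set v {1..p})\<^sup>2 \<le> qform p H v"
proof (cases "v = (\<lambda>j\<in>{1..p}. 0)")
  case True
  then have "\<And>j. j \<in> {1..p} \<Longrightarrow> v j = 0" by simp
  then show ?thesis by (simp add: L2_set_def qform_def)
next
  case False
  have sq: "(L2_set v {1..p})\<^sup>2 = (\<Sum>j=1..p. (v j)\<^sup>2)"
    unfolding L2_set_def by (intro real_sqrt_pow2 sum_nonneg) auto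
  have "\<exists>j\<in>{1..p}. v j \<noteq> 0"
    using v False by (fastforce simp: cone_set_def Rvec_def PiE_def extensional_def)
  then have pos: "0 < (\<Sum>j=1..p. (v j)\<^sup>2)"
    by (auto intro!: sum_pos2[where f = "\<lambda>j. (v j)\<^sup>2"])
  have "kappa p s H e \<le> ereal (qform p H v / (\<Sum>j=1..p. (v j)\<^sup>2))"
    unfolding kappa_def using v False by (intro INF_lower) auto
  with c have "ereal c < ereal (qform p H v / (\<Sum>j=1..p. (v j)\<^sup>2))" by (rule less_le_trans)
  then show ?thesis using pos unfolding sq by (simp add: field_simps)
qed

lemma (in prob_space) inner_prob_le_1: "inner_prob M A \<le> 1"
  unfolding inner_prob_def by (rule cSUP_least) auto

text \<open>Removing the measurable \<open>B\<close> from a measurable subset of \<open>A\<close>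
  leaves a measurable subset of \<open>C\<close>. Hence neither the model-size event nor the
  selection event has to be measurable.\<close>

lemma (in prob_space) inner_prob_diff_le:
  assumes B: "B \<in> events" and sub: "A - B \<subseteq> C"
  shows "inner_prob M A - prob B \<le> inner_prob M C"
proof -
  have "inner_prob M A \<le> inner_prob M C + prob B"
    unfolding inner_prob_def[of M A]
  proof (rule cSUP_least)
    fix E assume E: "E \<in> {E \<in> events. E \<subseteq> A}"
    then have "prob E \<le> prob ((E - B) \<union> B)" using B by (intro finite_measure_mono) auto
    also have "\<dots> \<le> prob (E - B) + prob B" using E B by (intro measure_Un_le) auto
    also have "prob (E - B) \<le> inner_prob M C"
      unfolding inner_prob_def using E B sub
      by (intro cSUP_upper) (auto intro!: bdd_aboveI[of _ 1])
    finally show "prob E \<le> inner_prob M C + prob B" by simp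
  qed auto
  then show ?thesis by simp
qed

text \<open>The maximal inequality produces \<open>ln (2 * p)\<close>, the rates are stated with
  \<open>max p 2\<close>; the bound \<open>2 * p \<le> (max p 2)\<^sup>2\<close> includes
  \<open>p = 1\<close>.\<close>

lemma ln_double_le: "1 \<le> p \<Longrightarrow> ln (2 * real p) \<le> 2 * ln (real (max p 2))"
proof -
  assume p: "1 \<le> p"
  have "2 * p \<le> (max p 2)\<^sup>2" using p by (cases "p = 1") (auto simp: power2_eq_square max_def)
  then have "2 * real p \<le> (real (max p 2))\<^sup>2" by (metis of_nat_le_iff of_nat_mult of_nat_numeral of_nat_power)
  then have "ln (2 * real p) \<le> ln ((real (max p 2))\<^sup>2)" using p by (subst ln_le_cancel_iff) auto
  then show ?thesis using p by (simp add: ln_realpow)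
qed

section \<open>Choice of the radii, failure probability and the limit\<close>

theorem corollary4:
  fixes M :: "nat \<Rightarrow> 'a measure"
    and p :: "nat \<Rightarrow> nat"
    and X :: "nat \<Rightarrow> 'a \<Rightarrow> nat \<Rightarrow> real" and Y :: "nat \<Rightarrow> 'a \<Rightarrow> nat"
    and Xs :: "nat \<Rightarrow> nat \<Rightarrow> 'a \<Rightarrow> nat \<Rightarrow> real" and Ys :: "nat \<Rightarrow> nat \<Rightarrow> 'a \<Rightarrow> nat"
    and \<rho> :: "real \<Rightarrow> nat \<Rightarrow> real" and L :: real
    and \<sigma> :: "nat \<Rightarrow> nat \<Rightarrow> real"
    and \<beta>s :: "nat \<Rightarrow> nat \<Rightarrow> real" and ss :: "nat \<Rightarrow> nat set"
    and k :: "nat \<Rightarrow> nat" and lam a :: "nat \<Rightarrow> real"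
    and H :: "nat \<Rightarrow> nat \<Rightarrow> nat \<Rightarrow> real"
    and \<tau> \<delta> \<epsilon>1 \<epsilon>2 \<theta> :: real
    and \<beta>L :: "nat \<Rightarrow> 'a \<Rightarrow> nat \<Rightarrow> real"
    and js :: "nat \<Rightarrow> 'a \<Rightarrow> nat list"
    and \<beta>hat :: "nat \<Rightarrow> 'a \<Rightarrow> nat set \<Rightarrow> nat \<Rightarrow> real"
    and shat :: "nat \<Rightarrow> 'a \<Rightarrow> nat set"
  defines "R \<equiv> \<lambda>n. risk \<rho> (p n) (M n) (X n) (Y n)"
    and "Rn \<equiv> \<lambda>n. emp_risk \<rho> (p n) n (Xs n) (Ys n)"
    and "MSS \<equiv> \<lambda>n \<omega>. nested_family (js n \<omega>)"
    and "bmin1 \<equiv> \<lambda>n. real_of_ereal (min (beta_min (p n) (\<beta>s n)) 1)"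
    and "logp \<equiv> \<lambda>n. ln (real (max (p n) 2))"
  assumes prob: "\<And>n. prob_space (M n)"
    and dim: "\<And>n. 1 \<le> p n"
    and XY_random: "\<And>n. (\<lambda>\<omega>. (X n \<omega>, Y n \<omega>)) \<in> measurable (M n) (XY_space (p n))"
    and indep: "\<And>n. prob_space.indep_vars (M n) (\<lambda>_. XY_space (p n))
           (\<lambda>i \<omega>. (Xs n i \<omega>, Ys n i \<omega>)) {1..n}"
    and ident: "\<And>n i. i \<in> {1..n} \<Longrightarrow>
           distr (M n) (XY_space (p n)) (\<lambda>\<omega>. (Xs n i \<omega>, Ys n i \<omega>)) =
           distr (M n) (XY_space (p n)) (\<lambda>\<omega>. (X n \<omega>, Y n \<omega>))"
    and sigma_nonneg: "\<And>n j. j \<in> {1..p n} \<Longrightarrow> 0 \<le> \<sigma> n j"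
    and subg: "\<And>n i j. i \<in> {1..n} \<Longrightarrow> j \<in> {1..p n} \<Longrightarrow>
           subgaussian (M n) (\<lambda>\<omega>. Xs n i \<omega> j) ((\<sigma> n j)\<^sup>2)"
    and sigma_bound: "limsup (\<lambda>n. ereal ((Max (\<sigma> n ` {1..p n}))\<^sup>2)) < \<infinity>"
    and nondegenerate: "\<And>n b c. b \<in> Rvec (p n) \<Longrightarrow> supp (p n) b \<noteq> {} \<Longrightarrow>
           \<not> (AE \<omega> in M n. dotp (p n) b (X n \<omega>) = c)"
    and L_pos: "L > 0"
    and rho_convex: "\<And>y. y \<in> {0, 1} \<Longrightarrow> convex_on UNIV (\<lambda>t. \<rho> t y)"
    and rho_lipschitz: "\<And>y. y \<in> {0, 1} \<Longrightarrow> L-lipschitz_on UNIV (\<lambda>t. \<rho> t y)"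
    and beta_star: "\<And>n. {b. is_arg_min (R n) (\<lambda>b. b \<in> Rvec (p n)) b} = {\<beta>s n}"
    and s_star: "\<And>n. ss n = supp (p n) (\<beta>s n)"
    and k_pos: "\<And>n. k n > 0" and lam_pos: "\<And>n. lam n > 0" and a_pos: "\<And>n. a n > 0"
    and lasso: "\<And>n \<omega>. \<omega> \<in> space (M n) \<Longrightarrow>
           selects_arg_min (\<lambda>b. Rn n \<omega> b + lam n * norm1 {1..p n} b) (Rvec (p n)) (\<beta>L n \<omega>)"
    and ordering: "\<And>n \<omega>. \<omega> \<in> space (M n) \<Longrightarrow> decreasing_order_of_supp (p n) (\<beta>L n \<omega>) (js n \<omega>)"
    and beta_hat: "\<And>n \<omega> w. \<omega> \<in> space (M n) \<Longrightarrow> w \<subseteq> {1..p n} \<Longrightarrow>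
           selects_arg_min (Rn n \<omega>) {b \<in> Rvec (p n). supp (p n) b \<subseteq> w} (\<beta>hat n \<omega> w)"
    and s_hat: "\<And>n \<omega>. \<omega> \<in> space (M n) \<Longrightarrow>
           is_arg_min (gic n (Rn n \<omega>) (\<beta>hat n \<omega>) (a n)) (\<lambda>w. w \<in> MSS n \<omega>) (shat n \<omega>)"
    and margin_consts: "\<tau> > 0" "\<delta> > 0" "\<epsilon>1 > 0"
    and H_nonneg: "\<And>n. nonneg_definite (p n) (H n)"
    and margin: "\<And>n b. b \<in> Rvec (p n) \<Longrightarrow>
           vdiff (p n) b (\<beta>s n) \<in> cone_set (p n) (ss n) \<epsilon>1 \<inter> l1_ball (p n) \<delta> \<Longrightarrow>
           R n b - R n (\<beta>s n) \<ge> \<tau> / 2 * qform (p n) (H n) (vdiff (p n) b (\<beta>s n))"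
    and convexity_consts: "\<epsilon>2 > 0" "\<theta> > 0"
    and strong_convexity: "\<And>n w b. w \<subseteq> {1..p n} \<Longrightarrow> card w \<le> k n \<Longrightarrow>
           b \<in> Rvec (p n) \<Longrightarrow> supp (p n) b \<subseteq> w \<Longrightarrow>
           L2_set (vdiff (p n) b (\<beta>s n)) {1..p n} \<le> \<epsilon>2 \<Longrightarrow>
           R n b - R n (\<beta>s n) \<ge> \<theta> * (L2_set (vdiff (p n) b (\<beta>s n)) {1..p n})\<^sup>2"
    and s_star_small: "\<And>n. card (ss n) \<le> k n"
    and MSS_small: "(\<lambda>n. inner_prob (M n) {\<omega> \<in> space (M n). \<forall>w\<in>MSS n \<omega>. card w \<le> k n}) \<longlonglongrightarrow> 1"
    and kappa_pos: "liminf (\<lambda>n. kappa (p n) (ss n) (H n) \<epsilon>1) > 0"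
    and rate_lam: "logp \<in> o(\<lambda>n. real n * (lam n)\<^sup>2)"
    and rate_k_lam: "(\<lambda>n. real (k n) * lam n) \<in> o(bmin1)"
    and rate_k_p: "(\<lambda>n. real (k n) * logp n) \<in> o(\<lambda>n. real n)"
    and rate_k_p_a: "(\<lambda>n. real (k n) * logp n) \<in> o(a)"
    and rate_a_k: "(\<lambda>n. a n * real (k n)) \<in> o(\<lambda>n. real n * (bmin1 n)\<^sup>2)"
  shows "(\<lambda>n. inner_prob (M n) {\<omega> \<in> space (M n). shat n \<omega> = ss n}) \<longlonglongrightarrow> 1"
proof -
  let ?w = "\<lambda>n b. vdiff (p n) b (\<beta>s n)"
  have n_ev: "\<forall>\<^sub>F n in sequentially. 1 \<le> n" by (rule eventually_ge_at_top)
  define m where "m = bmin1"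
  have m: "0 < m n" "m n \<le> 1" "\<And>i. i \<in> ss n \<Longrightarrow> m n \<le> \<bar>\<beta>s n i\<bar>" for n
    using real_of_ereal_beta_min[where p = "p n" and b = "\<beta>s n"] by (auto simp: m_def bmin1_def s_star)
  have logp: "0 < logp n" for n by (simp add: logp_def)
  have am: "is_arg_min (R n) (\<lambda>b. b \<in> Rvec (p n)) (\<beta>s n)" for n
    using beta_star[of n] by blast
  have bs: "\<beta>s n \<in> Rvec (p n)" "\<And>b. b \<in> Rvec (p n) \<Longrightarrow> R n (\<beta>s n) \<le> R n b" for n
    using am[of n] by (auto simp: is_arg_min_iff_le)
  have ss_sub: "ss n \<subseteq> {1..p n}" for n by (auto simp: s_star supp_def)
  obtain v where v: "0 \<le> v" "\<forall>\<^sub>F n in sequentially. (Max (\<sigma> n ` {1..p n}))\<^sup>2 < v"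
  proof -
    obtain v where "limsup (\<lambda>n. ereal ((Max (\<sigma> n ` {1..p n}))\<^sup>2)) < ereal v"
      using ereal_dense2[OF sigma_bound] by blast
    from Limsup_lessD[OF this] have "\<forall>\<^sub>F n in sequentially. (Max (\<sigma> n ` {1..p n}))\<^sup>2 < max v 0"
      by (rule eventually_mono) auto
    then show thesis by (intro that[of "max v 0"]) auto
  qed
  obtain \<kappa> where kap: "0 < \<kappa>" "\<forall>\<^sub>F n in sequentially. ereal \<kappa> < kappa (p n) (ss n) (H n) \<epsilon>1"
  proof -
    obtain \<kappa> where "0 < ereal \<kappa>" "ereal \<kappa> < liminf (\<lambda>n. kappa (p n) (ss n) (H n) \<epsilon>1)"
      using ereal_dense2[OF kappa_pos] by blast
    then show thesis using less_LiminfD by (intro that[of \<kappa>]) auto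
  qed
  \<comment> \<open>The curvature constant that the margin condition and the restricted eigenvalue
    bound give together on the cone.\<close>
  define K where "K = \<tau> / 2 * \<kappa>"
  have K: "0 < K" using kap margin_consts by (simp add: K_def)
  \<comment> \<open>Since \<open>m n \<le> 1\<close>, the radius \<open>\<rho>2 n = c * m n\<close>
    is at most \<open>\<epsilon>2\<close>, where the quadratic growth is available, and at most
    \<open>m n\<close>, so that any missing coordinate of \<open>ss n\<close> reaches it.\<close>
  define c where "c = min 1 \<epsilon>2"
  have c: "0 < c" "c \<le> 1" "c \<le> \<epsilon>2" using convexity_consts by (auto simp: c_def)
  \<comment> \<open>\<open>r\<close> gives equality in the requirement of
    \<open>lasso_localization\<close>. \<open>\<rho>1\<close> makes
    \<open>\<theta> * (\<rho>1 n)\<^sup>2 / 2\<close> equal to \<open>a n / (2 * real n)\<close>,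
    half the price of one coordinate on the scale of the empirical risk.\<close>
  define r where "r n = 6 * real (k n) * lam n / K" for n
  define \<rho>1 where "\<rho>1 n = sqrt (a n / (\<theta> * real n))" for n
  define \<rho>2 where "\<rho>2 n = c * m n" for n
  define Bad where "Bad n q t = {\<omega> \<in> space (M n). \<exists>b\<in>Rvec (p n). norm1 {1..p n} (?w n b) \<le> q \<and>
      t < (R n b - R n (\<beta>s n)) - (Rn n \<omega> b - Rn n \<omega> (\<beta>s n))}" for n q t
  define C where "C = 2 * L * (1 + v / 2) * sqrt 2"
  have C: "0 \<le> C" using L_pos v by (simp add: C_def)
  have prob_Bad: "Bad n q t \<in> sets (M n) \<and> measure (M n) (Bad n q t) \<le> C * sqrt (logp n / real n) * q / t"
    if n: "1 \<le> n" "(Max (\<sigma> n ` {1..p n}))\<^sup>2 < v" and q: "0 \<le> q" "0 < t" for n q t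
  proof -
    interpret prob_space "M n" by (rule prob)
    \<comment> \<open>The moment bounds are stated for the sample, so the common law is represented
      by the first observation.\<close>
    have one: "1 \<in> {1..n}" using n by simp
    have rv1: "(\<lambda>\<omega>. (Xs n 1 \<omega>, Ys n 1 \<omega>)) \<in> measurable (M n) (XY_space (p n))"
      using indep[of n] one by (auto simp: indep_vars_def)
    have sig: "(\<sigma> n j)\<^sup>2 \<le> v" if j: "j \<in> {1..p n}" for j
    proof -
      have "\<sigma> n j \<le> Max (\<sigma> n ` {1..p n})" using j by (intro Max_ge) auto
      then have "(\<sigma> n j)\<^sup>2 \<le> (Max (\<sigma> n ` {1..p n}))\<^sup>2" using sigma_nonneg[OF j] by (intro power_mono) auto
      then show ?thesis using n(2) by linarith
    qed
    have D: "lipschitz_risk (distr (M n) (XY_space (p n)) (\<lambda>\<omega>. (X n \<omega>, Y n \<omega>))) (p n) \<rho> L v"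
      unfolding ident[OF one, symmetric]
      by (rule lipschitz_risk_distr[OF prob rv1 dim rho_lipschitz subg[OF one] sig])
    note dev = prob_deviation_le[OF D XY_random indep ident n(1) q bs(1)]
    have "sqrt (ln (2 * real (p n)) / real n) \<le> sqrt (2 * logp n / real n)"
      using ln_double_le[OF dim[of n]] by (intro real_sqrt_le_mono divide_right_mono) (simp_all add: logp_def)
    also have "\<dots> = sqrt 2 * sqrt (logp n / real n)" by (simp add: real_sqrt_mult real_sqrt_divide)
    finally have "2 * L * q * (1 + v / 2) * sqrt (ln (2 * real (p n)) / real n) / t
        \<le> 2 * L * q * (1 + v / 2) * (sqrt 2 * sqrt (logp n / real n)) / t"
      using L_pos v q by (intro divide_right_mono mult_left_mono) auto
    also have "\<dots> = C * sqrt (logp n / real n) * q / t" by (simp add: C_def)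
    finally show ?thesis
      using dev unfolding Bad_def R_def Rn_def by (auto intro: order_trans)
  qed
  define x1 where "x1 n = logp n / (real n * (lam n)\<^sup>2)" for n
  define x2 where "x2 n = real (k n) * lam n / m n" for n
  define x3 where "x3 n = real (k n) * logp n / a n" for n
  define x4 where "x4 n = a n * real (k n) / (real n * (m n)\<^sup>2)" for n
  have x1: "x1 \<longlonglongrightarrow> 0" using smalloD_tendsto[OF rate_lam] unfolding x1_def .
  have x2: "x2 \<longlonglongrightarrow> 0" using smalloD_tendsto[OF rate_k_lam] unfolding x2_def m_def .
  have x3: "x3 \<longlonglongrightarrow> 0" using smalloD_tendsto[OF rate_k_p_a] unfolding x3_def .
  have x4: "x4 \<longlonglongrightarrow> 0" using smalloD_tendsto[OF rate_a_k] unfolding x4_def m_def .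
  \<comment> \<open>One summand for each part of \<open>B n\<close>. The third stems from \<open>k *
    logp / (n * \<rho>2\<^sup>2) = x3 * (a / (n * m\<^sup>2)) / c\<^sup>2\<close>, which is at most
    \<open>x3 * x4 / c\<^sup>2\<close> because \<open>k\<close> is at least 1.\<close>
  define err where "err n = C * (4 * sqrt (x1 n) + 2 / \<theta> * sqrt (\<theta> * x3 n) + 2 / \<theta> * sqrt (x3 n * x4 n / c\<^sup>2))" for n
  have err: "err \<longlonglongrightarrow> 0"
  proof -
    have "err \<longlonglongrightarrow> C * (4 * sqrt 0 + 2 / \<theta> * sqrt (\<theta> * 0) + 2 / \<theta> * sqrt (0 * 0 / c\<^sup>2))"
      unfolding err_def[abs_def] using c by (intro tendsto_intros x1 x3 x4) auto
    then show ?thesis by simp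
  qed
  define B where "B n = Bad n (r n) (lam n * r n / 4) \<union> Bad n (sqrt (real (k n)) * \<rho>1 n) (\<theta> * (\<rho>1 n)\<^sup>2 / 2)
    \<union> Bad n (sqrt (real (k n)) * \<rho>2 n) (\<theta> * (\<rho>2 n)\<^sup>2 / 2)" for n
  have r_pos: "0 < r n" for n using K k_pos[of n] lam_pos[of n] by (simp add: r_def)
  have \<rho>1: "0 < \<rho>1 n" "(\<rho>1 n)\<^sup>2 = a n / (\<theta> * real n)" if "1 \<le> n" for n
    using a_pos[of n] convexity_consts that by (auto simp: \<rho>1_def)
  have \<rho>2: "0 < \<rho>2 n" for n using c m[of n] by (simp add: \<rho>2_def)
  have rate: "C * sqrt (logp n / real n) * (sqrt (real (k n)) * q) / (\<theta> * q\<^sup>2 / 2)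
      = C * (2 / \<theta> * sqrt (real (k n) * logp n / (real n * q\<^sup>2)))" if "0 < q" for n q
  proof -
    have "sqrt (real (k n) * logp n / (real n * q\<^sup>2)) = sqrt (logp n / real n) * sqrt (real (k n)) / q"
      using that by (simp add: real_sqrt_mult real_sqrt_divide mult_ac)
    then show ?thesis using that convexity_consts by (simp add: power2_eq_square field_simps)
  qed
  have B_ev: "B n \<in> sets (M n) \<and> measure (M n) (B n) \<le> err n"
    if n: "1 \<le> n" "(Max (\<sigma> n ` {1..p n}))\<^sup>2 < v" for n
  proof -
    have k1: "1 \<le> real (k n)" using k_pos[of n] by simp
    let ?B1 = "Bad n (r n) (lam n * r n / 4)" and ?B2 = "Bad n (sqrt (real (k n)) * \<rho>1 n) (\<theta> * (\<rho>1 n)\<^sup>2 / 2)"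
      and ?B3 = "Bad n (sqrt (real (k n)) * \<rho>2 n) (\<theta> * (\<rho>2 n)\<^sup>2 / 2)"
    have 1: "?B1 \<in> sets (M n)" "measure (M n) ?B1 \<le> C * sqrt (logp n / real n) * r n / (lam n * r n / 4)"
      using prob_Bad[OF n, of "r n" "lam n * r n / 4"] r_pos[of n] lam_pos[of n] by auto
    have 2: "?B2 \<in> sets (M n)" "measure (M n) ?B2 \<le> C * sqrt (logp n / real n) * (sqrt (real (k n)) * \<rho>1 n) / (\<theta> * (\<rho>1 n)\<^sup>2 / 2)"
      using prob_Bad[OF n, of "sqrt (real (k n)) * \<rho>1 n" "\<theta> * (\<rho>1 n)\<^sup>2 / 2"] \<rho>1(1)[OF n(1)] convexity_consts by auto
    have 3: "?B3 \<in> sets (M n)" "measure (M n) ?B3 \<le> C * sqrt (logp n / real n) * (sqrt (real (k n)) * \<rho>2 n) / (\<theta> * (\<rho>2 n)\<^sup>2 / 2)"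
      using prob_Bad[OF n, of "sqrt (real (k n)) * \<rho>2 n" "\<theta> * (\<rho>2 n)\<^sup>2 / 2"] \<rho>2[of n] convexity_consts by auto
    have b1: "C * sqrt (logp n / real n) * r n / (lam n * r n / 4) = C * (4 * sqrt (x1 n))"
      using r_pos[of n] lam_pos[of n] by (simp add: x1_def real_sqrt_mult real_sqrt_divide)
    have b2: "real (k n) * logp n / (real n * (\<rho>1 n)\<^sup>2) = \<theta> * x3 n"
      unfolding \<rho>1(2)[OF n(1)] x3_def using n(1) convexity_consts by simp
    have "real (k n) * logp n / (real n * (\<rho>2 n)\<^sup>2) = x3 n * (a n / (real n * (m n)\<^sup>2)) / c\<^sup>2"
      using a_pos[of n] by (simp add: x3_def \<rho>2_def power_mult_distrib)
    also have "\<dots> \<le> x3 n * x4 n / c\<^sup>2"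
    proof (intro divide_right_mono mult_left_mono)
      show "a n / (real n * (m n)\<^sup>2) \<le> x4 n"
        unfolding x4_def using a_pos[of n] k1 by (intro divide_right_mono) auto
      show "0 \<le> x3 n" using a_pos[of n] logp[of n] by (simp add: x3_def)
    qed auto
    finally have b3: "real (k n) * logp n / (real n * (\<rho>2 n)\<^sup>2) \<le> x3 n * x4 n / c\<^sup>2" .
    have "measure (M n) (B n) \<le> measure (M n) ?B1 + measure (M n) ?B2 + measure (M n) ?B3"
      unfolding B_def using measure_Un_le[OF 1(1) 2(1)] measure_Un_le[OF sets.Un[OF 1(1) 2(1)] 3(1)] by linarith
    also have "\<dots> \<le> C * (4 * sqrt (x1 n)) + C * (2 / \<theta> * sqrt (\<theta> * x3 n)) + C * (2 / \<theta> * sqrt (x3 n * x4 n / c\<^sup>2))"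
    proof (intro add_mono)
      show "measure (M n) ?B1 \<le> C * (4 * sqrt (x1 n))" using 1(2) unfolding b1 .
      show "measure (M n) ?B2 \<le> C * (2 / \<theta> * sqrt (\<theta> * x3 n))"
        using 2(2) unfolding rate[OF \<rho>1(1)[OF n(1)]] b2 .
      have "C * (2 / \<theta> * sqrt (real (k n) * logp n / (real n * (\<rho>2 n)\<^sup>2))) \<le> C * (2 / \<theta> * sqrt (x3 n * x4 n / c\<^sup>2))"
        using C convexity_consts b3 by (intro mult_left_mono real_sqrt_le_mono) auto
      with 3(2) show "measure (M n) ?B3 \<le> C * (2 / \<theta> * sqrt (x3 n * x4 n / c\<^sup>2))"
        unfolding rate[OF \<rho>2] by (rule order_trans)
    qed
    also have "\<dots> = err n" by (simp add: err_def distrib_left)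
    finally show ?thesis using 1(1) 2(1) 3(1) by (auto simp: B_def)
  qed
  \<comment> \<open>The sample is fixed from here on. The bounds on \<open>x2\<close> give
    \<open>r n < m n / 2\<close>, for separation, and \<open>r n \<le> \<delta>\<close>, for the
    margin condition. Those on \<open>x4\<close> make the loss of smaller models exceed
    \<open>a n * k n\<close> and give \<open>\<rho>1 n \<le> \<epsilon>2\<close>.\<close>
  have select: "shat n \<omega> = ss n"
    if n: "1 \<le> n" "ereal \<kappa> < kappa (p n) (ss n) (H n) \<epsilon>1" "x2 n < min (K / 12) (K * \<delta> / 6)"
      "x4 n < min (\<theta> * c\<^sup>2 / 2) (\<theta> * \<epsilon>2\<^sup>2)"
      and \<omega>: "\<omega> \<in> space (M n)" "\<omega> \<notin> B n" and small: "\<And>w. w \<in> MSS n \<omega> \<Longrightarrow> card w \<le> k n" for n \<omega>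
  proof -
    interpret prob_space "M n" by (rule prob)
    have Ys: "Ys n i \<omega> \<in> {0, 1}" if "i \<in> {1..n}" for i
    proof -
      have "(\<lambda>\<omega>. (Xs n i \<omega>, Ys n i \<omega>)) \<in> measurable (M n) (XY_space (p n))"
        using indep[of n] that by (auto simp: indep_vars_def)
      from measurable_space[OF this \<omega>(1)] show ?thesis by (simp add: XY_space_def space_pair_measure)
    qed
    have cont: "continuous_on (Rvec (p n)) (Rn n \<omega>)"
      unfolding Rn_def using rho_lipschitz Ys by (rule continuous_on_emp_risk)
    have conv: "Rn n \<omega> (\<lambda>j\<in>{1..p n}. (1 - s) * c j + s * b j) \<le> (1 - s) * Rn n \<omega> c + s * Rn n \<omega> b"
      if "0 \<le> s" "s \<le> 1" for b c s
      unfolding Rn_def using rho_convex Ys that by (rule emp_risk_convex)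
    have good: "(R n b - R n (\<beta>s n)) - (Rn n \<omega> b - Rn n \<omega> (\<beta>s n)) \<le> t"
      if "\<omega> \<notin> Bad n q t" "b \<in> Rvec (p n)" "norm1 {1..p n} (?w n b) \<le> q" for b q t
      using that \<omega>(1) unfolding Bad_def by (force simp: not_less)
    have \<omega>B: "\<omega> \<notin> Bad n (r n) (lam n * r n / 4)" "\<omega> \<notin> Bad n (sqrt (real (k n)) * \<rho>1 n) (\<theta> * (\<rho>1 n)\<^sup>2 / 2)"
      "\<omega> \<notin> Bad n (sqrt (real (k n)) * \<rho>2 n) (\<theta> * (\<rho>2 n)\<^sup>2 / 2)"
      using \<omega>(2) by (auto simp: B_def)
    have n0: "0 < real n" using n(1) by simp
    have k1: "1 \<le> real (k n)" using k_pos[of n] by simp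
    have kl: "real (k n) * lam n < K / 12 * m n" "real (k n) * lam n < K * \<delta> / 6 * m n"
      using n(3) m(1)[of n] by (auto simp: x2_def pos_divide_less_eq)
    have r_m: "r n < m n / 2" using kl(1) K by (simp add: r_def field_simps)
    have "K * \<delta> / 6 * m n \<le> K * \<delta> / 6 * 1" using K margin_consts m by (intro mult_left_mono) auto
    then have "real (k n) * lam n \<le> K * \<delta> / 6" using kl(2) by linarith
    then have r_\<delta>: "r n \<le> \<delta>" using K by (simp add: r_def field_simps)
    have marg: "K * (L2_set (?w n b) {1..p n})\<^sup>2 \<le> R n b - R n (\<beta>s n)"
      if b: "b \<in> Rvec (p n)" "?w n b \<in> cone_set (p n) (ss n) \<epsilon>1" "norm1 {1..p n} (?w n b) \<le> r n" for b
    proof -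
      have "?w n b \<in> l1_ball (p n) \<delta>" using b(3) r_\<delta> by (simp add: l1_ball_def vdiff_in_Rvec)
      then have "\<tau> / 2 * qform (p n) (H n) (?w n b) \<le> R n b - R n (\<beta>s n)" using margin[of b n] b by simp
      moreover have "\<tau> / 2 * (\<kappa> * (L2_set (?w n b) {1..p n})\<^sup>2) \<le> \<tau> / 2 * qform (p n) (H n) (?w n b)"
        using margin_consts kappa_mult_le_qform[OF n(2) b(2)] by (intro mult_left_mono) auto
      ultimately show ?thesis by (simp add: K_def mult.assoc)
    qed
    have "norm1 {1..p n} (vdiff (p n) (\<beta>L n \<omega>) (\<beta>s n)) < r n"
    proof (rule lasso_localization[OF cont conv bs(1) s_star[symmetric] s_star_small bs(2) marg lam_pos K r_pos margin_consts(3)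
          _ good[OF \<omega>B(1)] lasso[OF \<omega>(1)]])
      show "6 * real (k n) * lam n \<le> K * r n" using K by (simp add: r_def)
    qed
    then have close: "\<bar>\<beta>L n \<omega> j - \<beta>s n j\<bar> < m n / 2" if "j \<in> {1..p n}" for j
      using abs_le_norm1[OF finite_atLeastAtMost that, of "vdiff (p n) (\<beta>L n \<omega>) (\<beta>s n)"] r_m that
      by (simp add: vdiff_def)
    have sep: "ss n \<in> MSS n \<omega>" "\<And>w. w \<in> MSS n \<omega> \<Longrightarrow> w \<subseteq> {1..p n} \<and> (w \<subseteq> ss n \<or> ss n \<subseteq> w)"
      using nested_family_separation[OF close m(3)[unfolded s_star] ordering[OF \<omega>(1)]]
      by (simp_all add: MSS_def s_star)
    have ak: "a n * real (k n) < \<theta> * c\<^sup>2 / 2 * (real n * (m n)\<^sup>2)" "a n * real (k n) < \<theta> * \<epsilon>2\<^sup>2 * (real n * (m n)\<^sup>2)"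
      using n(4) m(1)[of n] n0 by (auto simp: x4_def pos_divide_less_eq)
    have "(\<rho>1 n)\<^sup>2 \<le> \<epsilon>2\<^sup>2"
    proof -
      have "a n * 1 \<le> a n * real (k n)" using a_pos[of n] k1 by (intro mult_left_mono) auto
      also have "\<dots> \<le> \<theta> * \<epsilon>2\<^sup>2 * (real n * (m n)\<^sup>2)" using ak(2) by simp
      also have "\<dots> \<le> \<theta> * \<epsilon>2\<^sup>2 * (real n * 1)"
        using m[of n] convexity_consts by (intro mult_left_mono) (auto simp: power_le_one)
      finally show ?thesis unfolding \<rho>1(2)[OF n(1)] using n0 convexity_consts by (simp add: field_simps)
    qed
    then have \<rho>1_le: "\<rho>1 n \<le> \<epsilon>2" using convexity_consts by (simp add: power2_le_iff_abs_le)
    have "c * m n \<le> \<epsilon>2 * 1" using c m[of n] by (intro mult_mono) auto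
    then have \<rho>2_le: "\<rho>2 n \<le> \<epsilon>2" by (simp add: \<rho>2_def)
    have "c * m n \<le> 1 * m n" using c m[of n] by (intro mult_right_mono) auto
    then have \<rho>2_m: "\<rho>2 n \<le> m n" by (simp add: \<rho>2_def)
    have strong: "\<theta> * (L2_set (?w n b) {1..p n})\<^sup>2 \<le> R n b - R n (\<beta>s n)"
      if "W \<subseteq> {1..p n}" "card W \<le> k n" "q \<le> \<epsilon>2" "b \<in> Rvec (p n)" "supp (p n) b \<subseteq> W" "L2_set (?w n b) {1..p n} \<le> q" for b q W
      using strong_convexity[OF that(1,2,4,5)] that by simp
    have supp_s: "supp (p n) (\<beta>s n) \<subseteq> W" if "ss n \<subseteq> W" for W using that s_star by simp
    note over = restricted_min_bounds(1,2)[OF cont conv bs(1) supp_s _ _ bs(2) strong[OF _ _ \<rho>1_le] \<rho>1(1)[OF n(1)]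
        convexity_consts(2) good[OF \<omega>B(2)]]
    note under = restricted_min_bounds(3)[OF cont conv bs(1) supp_s _ _ bs(2) strong[OF _ _ \<rho>2_le] \<rho>2
        convexity_consts(2) good[OF \<omega>B(3)]]
    have half: "\<theta> * (\<rho>1 n)\<^sup>2 / 2 = a n / (2 * real n)"
      unfolding \<rho>1(2)[OF n(1)] using convexity_consts by simp
    show ?thesis
    proof (rule gic_selects[OF n(1) a_pos sep(1) s_star_small, where f = "Rn n \<omega>" and bh = "\<beta>hat n \<omega>" and t = "\<theta> * (\<rho>2 n)\<^sup>2 / 2" and c = "Rn n \<omega> (\<beta>s n)"])
      show "finite w \<and> (w \<subseteq> ss n \<or> ss n \<subseteq> w)" if "w \<in> MSS n \<omega>" for w
        using sep(2)[OF that] finite_subset by blast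
      show "Rn n \<omega> (\<beta>hat n \<omega> (ss n)) \<le> Rn n \<omega> (\<beta>s n)"
        by (rule over(1)[where W = "ss n" and w = "ss n"])
           (use ss_sub s_star_small supp_s beta_hat[OF \<omega>(1) ss_sub] in auto)
      \<comment> \<open>Here the bound on model sizes enters: \<open>w\<close> plays the role of
        \<open>W\<close> and must have at most \<open>k n\<close> elements.\<close>
      show "Rn n \<omega> (\<beta>s n) - a n / (2 * real n) \<le> Rn n \<omega> (\<beta>hat n \<omega> w)" if "w \<in> MSS n \<omega>" "ss n \<subset> w" for w
        unfolding half[symmetric]
        by (rule over(2)[where W = w and w = w])
           (use that sep(2)[OF that(1)] small[OF that(1)] supp_s beta_hat[OF \<omega>(1)] in auto)
      show "Rn n \<omega> (\<beta>s n) + \<theta> * (\<rho>2 n)\<^sup>2 / 2 \<le> Rn n \<omega> (\<beta>hat n \<omega> w)" if w: "w \<in> MSS n \<omega>" "w \<subset> ss n" for w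
      proof -
        obtain i where i: "i \<in> ss n" "i \<notin> w" using w(2) by blast
        show ?thesis
        proof (rule under[where W = "ss n" and w = w and i = i])
          show "\<rho>2 n \<le> \<bar>\<beta>s n i\<bar>" using \<rho>2_m m(3)[OF i(1)] by linarith
        qed (use w i ss_sub s_star_small s_star sep(2)[OF w(1)] beta_hat[OF \<omega>(1)] in auto)
      qed
      show "a n * real (k n) < real n * (\<theta> * (\<rho>2 n)\<^sup>2 / 2)"
        using ak(1) by (simp add: \<rho>2_def power_mult_distrib mult_ac)
      show "is_arg_min (gic n (Rn n \<omega>) (\<beta>hat n \<omega>) (a n)) (\<lambda>w. w \<in> MSS n \<omega>) (shat n \<omega>)"
        by (rule s_hat[OF \<omega>(1)])
    qed
  qed
  let ?A = "\<lambda>n. {\<omega> \<in> space (M n). \<forall>w\<in>MSS n \<omega>. card w \<le> k n}"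
  let ?S = "\<lambda>n. {\<omega> \<in> space (M n). shat n \<omega> = ss n}"
  have "\<forall>\<^sub>F n in sequentially. x2 n < min (K / 12) (K * \<delta> / 6)"
    using x2 by (rule order_tendstoD) (use K margin_consts in simp)
  moreover have "\<forall>\<^sub>F n in sequentially. x4 n < min (\<theta> * c\<^sup>2 / 2) (\<theta> * \<epsilon>2\<^sup>2)"
    using x4 by (rule order_tendstoD) (use c convexity_consts in simp)
  ultimately have "\<forall>\<^sub>F n in sequentially. inner_prob (M n) (?A n) - err n \<le> inner_prob (M n) (?S n)"
    using n_ev v(2) kap(2)
  proof eventually_elim
    case (elim n)
    interpret prob_space "M n" by (rule prob)
    \<comment> \<open>Only \<open>B n\<close> is known to be measurable; it is subtracted, and the
      other two events are compared through inner probabilities.\<close>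
    have "?A n - B n \<subseteq> ?S n" using select elim by blast
    then have "inner_prob (M n) (?A n) - measure (M n) (B n) \<le> inner_prob (M n) (?S n)"
      using B_ev elim by (intro inner_prob_diff_le) auto
    then show ?case using B_ev[of n] elim by linarith
  qed
  moreover have "\<forall>\<^sub>F n in sequentially. inner_prob (M n) (?S n) \<le> 1"
    using prob_space.inner_prob_le_1[OF prob] by simp
  moreover have "(\<lambda>n. inner_prob (M n) (?A n) - err n) \<longlonglongrightarrow> 1"
    using tendsto_diff[OF MSS_small err] by simp
  ultimately show ?thesis by (rule tendsto_sandwich[OF _ _ _ tendsto_const])
qed

end
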